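(* Let $\beta\in C^1([0,+\infty))$ be (strictly) increasing with $\beta(0)=0$ and $\beta^\infty:=\lim_{r\to+\infty}\beta(r)<+\infty$. Let $V\in C^2(\mathbb R)$ and $\lambda\in\mathbb R$ satisfy $V''\ge\lambda$ on $\mathbb R$ and $\liminf_{|x|\to+\infty}V(x)/|x|^2\ge 0$. Let $\mathfrak m>0$. Then $\mathcal F$ is lower semicontinuous with respect to the Wasserstein distance in $\mathscr M_2(\mathbb R,\mathfrak m)$ and displacement $\lambda$-convex. Moreover $\mathcal F$ satisfies the coercivity property $$\inf\Big\{\mathcal F(\rho):\rho\in\mathscr M_2(\mathbb R,\mathfrak m),\ \int_{\mathbb R}|x|^2\,d\rho(x)\le C\Big\}>-\infty\qquad\text{for every }C>0.$$
   Context: $\mathscr M_2(\mathbb R,\mathfrak m)$ is the set of nonnegative Borel measures on $\mathbb R$ with mass $\mathfrak m$ and finite second moment, endowed with $W_2^2(\rho^1,\rho^2)=\min\int|x-y|^2d\boldsymbol\rho(x,y)$ over couplings $\boldsymbol\rho$ (measures on $\mathbb R^2$ of mass $\mathfrak m$ with marginals $\rho^1,\rho^2$); the optimal coupling $\boldsymbol\rho_{\rm opt}$ is unique. $E(r):=-\beta(r)-r\int_r^{+\infty}\frac{\beta'(s)}s\,ds$, $E(0)=0$; for $\rho=u\mathscr L^1+\rho^\perp$ (Lebesgue decomposition), $\mathcal F(\rho):=\int_{\mathbb R}E(u)\,dx+\int_{\mathbb R}V\,d\rho$. Displacement interpolation: for $\rho^0,\rho^1\in\mathscr M_2(\mathbb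 R,\mathfrak m)$ and $\vartheta\in[0,1]$, $\rho^\vartheta:=((1-\vartheta)\pi^1+\vartheta\pi^2)_\#\boldsymbol\rho_{\rm opt}$, where $\pi^1,\pi^2$ are the coordinate projections of $\mathbb R^2$. A functional $\mathcal G:\mathscr M_2(\mathbb R,\mathfrak m)\to(-\infty,+\infty]$ is displacement $\lambda$-convex if for all $\rho^0,\rho^1$ in its proper domain and $\vartheta\in[0,1]$, $\mathcal G(\rho^\vartheta)\le(1-\vartheta)\mathcal G(\rho^0)+\vartheta\mathcal G(\rho^1)-\frac\lambda2\vartheta(1-\vartheta)W_2^2(\rho^0,\rho^1)$. *)

theory Defs
  imports "HOL-Analysis.Analysis"
begin

text \<open>Derivatives are taken relative to \<open>S\<close>, hence one-sided at the endpoint of \<open>{0..}\<close>.\<close>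

definition C1_on :: "real set \<Rightarrow> (real \<Rightarrow> real) \<Rightarrow> bool" where
  "C1_on S f \<longleftrightarrow>
     (\<exists>f'. (\<forall>x\<in>S. (f has_real_derivative f' x) (at x within S)) \<and> continuous_on S f')"

definition C2 :: "(real \<Rightarrow> real) \<Rightarrow> bool" where
  "C2 f \<longleftrightarrow> C1_on UNIV f \<and> C1_on UNIV (deriv f)"

text \<open>
  Integral with values in the extended reals: positive part minus negative part, each of which
  may be infinite. Note that \<open>\<infinity> - \<infinity> = \<infinity>\<close> in \<^typ>\<open>ereal\<close>.
\<close>

definition ext_integral :: "'a measure \<Rightarrow> ('a \<Rightarrow> real) \<Rightarrow> ereal" where
  "ext_integral M f =
     enn2ereal (\<integral>\<^sup>+ x. ennreal (f x) \<partial>M) - enn2ereal (\<integral>\<^sup>+ x. ennreal (- f x) \<partial>M)"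

definition M2 :: "real \<Rightarrow> real measure set" where
  "M2 m = {\<rho>. sets \<rho> = sets borel \<and> emeasure \<rho> (space \<rho>) = ennreal m \<and>
               (\<integral>\<^sup>+ x. ennreal (x\<^sup>2) \<partial>\<rho>) < \<infinity>}"

text \<open>The mass of a coupling is that of its marginals.\<close>

definition couplings :: "real measure \<Rightarrow> real measure \<Rightarrow> (real \<times> real) measure set" where
  "couplings \<rho>1 \<rho>2 = {\<gamma>. sets \<gamma> = sets borel \<and> distr \<gamma> borel fst = \<rho>1 \<and> distr \<gamma> borel snd = \<rho>2}"

definition transport_cost :: "(real \<times> real) measure \<Rightarrow> ennreal" where
  "transport_cost \<gamma> = (\<integral>\<^sup>+ (x, y). ennreal (\<bar>x - y\<bar>\<^sup>2) \<partial>\<gamma>)"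

definition W2 :: "real measure \<Rightarrow> real measure \<Rightarrow> real" where
  "W2 \<rho>1 \<rho>2 = sqrt (enn2real (INF \<gamma>\<in>couplings \<rho>1 \<rho>2. transport_cost \<gamma>))"

definition optimal_coupling :: "real measure \<Rightarrow> real measure \<Rightarrow> (real \<times> real) measure" where
  "optimal_coupling \<rho>1 \<rho>2 =
     (THE \<gamma>. \<gamma> \<in> couplings \<rho>1 \<rho>2 \<and> (\<forall>\<gamma>'\<in>couplings \<rho>1 \<rho>2. transport_cost \<gamma> \<le> transport_cost \<gamma>'))"

definition displacement_interpolation ::
  "real measure \<Rightarrow> real measure \<Rightarrow> real \<Rightarrow> real measure" where
  "displacement_interpolation \<rho>0 \<rho>1 \<theta> =
     distr (optimal_coupling \<rho>0 \<rho>1) borel (\<lambda>(x, y). (1 - \<theta>) * x + \<theta> * y)"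

text \<open>The first conjunct says that \<open>G\<close> takes values in \<open>(-\<infinity>, +\<infinity>]\<close> on \<open>M2 m\<close>.\<close>

definition displacement_convex :: "real \<Rightarrow> real \<Rightarrow> (real measure \<Rightarrow> ereal) \<Rightarrow> bool" where
  "displacement_convex m lam G \<longleftrightarrow>
     (\<forall>\<rho>\<in>M2 m. G \<rho> > -\<infinity>) \<and>
     (\<forall>\<rho>0\<in>M2 m. \<forall>\<rho>1\<in>M2 m. \<forall>\<theta>\<in>{0..1}. G \<rho>0 < \<infinity> \<longrightarrow> G \<rho>1 < \<infinity> \<longrightarrow>
        G (displacement_interpolation \<rho>0 \<rho>1 \<theta>) \<le>
          ereal (1 - \<theta>) * G \<rho>0 + ereal \<theta> * G \<rho>1
            - ereal (lam / 2 * \<theta> * (1 - \<theta>) * (W2 \<rho>0 \<rho>1)\<^sup>2))"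

definition W2_lower_semicontinuous :: "real \<Rightarrow> (real measure \<Rightarrow> ereal) \<Rightarrow> bool" where
  "W2_lower_semicontinuous m G \<longleftrightarrow>
     (\<forall>\<rho>\<in>M2 m. \<forall>a < G \<rho>. \<exists>\<delta>>0. \<forall>\<sigma>\<in>M2 m. W2 \<rho> \<sigma> < \<delta> \<longrightarrow> a < G \<sigma>)"

definition lebesgue_decomposition ::
  "real measure \<Rightarrow> (real \<Rightarrow> real) \<Rightarrow> real measure \<Rightarrow> bool" where
  "lebesgue_decomposition \<rho> u \<rho>s \<longleftrightarrow>
     u \<in> borel_measurable borel \<and> (\<forall>x. u x \<ge> 0) \<and>
     sets \<rho>s = sets borel \<and>
     (\<exists>N\<in>sets borel. emeasure lborel N = 0 \<and> emeasure \<rho>s (- N) = 0) \<and>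
     (\<forall>A\<in>sets borel. emeasure \<rho> A = (\<integral>\<^sup>+ x\<in>A. ennreal (u x) \<partial>lborel) + emeasure \<rho>s A)"

text \<open>The density is only determined up to a Lebesgue null set.\<close>

definition ac_density :: "real measure \<Rightarrow> real \<Rightarrow> real" where
  "ac_density \<rho> = (SOME u. \<exists>\<rho>s. lebesgue_decomposition \<rho> u \<rho>s)"

definition E_fun :: "(real \<Rightarrow> real) \<Rightarrow> real \<Rightarrow> real" where
  "E_fun \<beta> r = (if r = 0 then 0 else - \<beta> r - r * (LBINT s:{r..}. deriv \<beta> s / s))"

definition F_fun :: "(real \<Rightarrow> real) \<Rightarrow> (real \<Rightarrow> real) \<Rightarrow> real measure \<Rightarrow> ereal" where
  "F_fun \<beta> V \<rho> = ext_integral lborel (\<lambda>x. E_fun \<beta> (ac_density \<rho> x)) + ext_integral \<rho> V"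

end

theory Submission
  imports Defs "HOL-Probability.Weak_Convergence"
begin

text \<open>
  The key is a layer formula: for \<open>r \<ge> 0\<close>,
  \<open>- E r = (\<integral> s \<in> {0<..}. \<beta>' s / s * min r s)\<close>. By Tonelli, the internal energy of \<open>\<rho>\<close> is
  \<open>- (\<integral> s \<in> {0<..}. \<beta>' s / s * \<Phi> s \<rho>)\<close> with \<open>\<Phi> s \<rho> = (\<integral> x. min (u x) s)\<close>, the mass of the absolutely
  continuous part cut off at density \<open>s\<close>, and with a nonnegative weight \<open>\<beta>' s / s\<close>. So the assertions
  about the internal energy follow from upper semicontinuity, displacement concavity and an upper
  bound for each \<open>\<Phi> s\<close>. These in turn rest on the dual formula
  \<open>\<Phi> s \<rho> = (INF A. \<rho> A + s * \<lambda> (- A))\<close> over Borel sets \<open>A\<close> (\<open>capped_mass\<close>, \<open>capped_mass_eq\<close>),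
  which accounts for the singular part of \<open>\<rho>\<close> without splitting it off.

  \<^item> Semicontinuity: by outer regularity \<open>A\<close> may be taken closed, and \<open>\<rho> \<mapsto> \<rho> A\<close> is then upper
    semicontinuous. Domination in \<open>s\<close> and Fatou's lemma carry this over to the integral.

  \<^item> Concavity: the optimal coupling is the joint law of the two quantile functions, so that
    \<open>\<rho>\<^sup>\<theta>\<close> is the law of \<open>Z = (1 - \<theta>) X + \<theta> Y\<close> with \<open>X\<close> and \<open>Y\<close> monotone. If \<open>Z\<close> stays in an interval
    of length \<open>l\<close> for some levels, then over these levels \<open>X\<close> and \<open>Y\<close> stay in intervals of lengths \<open>a\<close>
    and \<open>b\<close> with \<open>(1 - \<theta>) a + \<theta> b \<le> l\<close>. Splitting the open set \<open>- A\<close> into its components thus turns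
    a competitor for \<open>\<rho>\<^sup>\<theta>\<close> into competitors for both endpoints (\<open>capped_mass_concave\<close>).

  \<^item> Bound: for \<open>s \<le> 1\<close>, the choice \<open>A = - {-R..R}\<close> with \<open>R = 1 / sqrt s\<close> and Chebyshev's inequality
    give \<open>\<Phi> s \<rho> \<le> C * sqrt s\<close>, and for larger \<open>s\<close> the total mass is such a bound. Here \<open>C\<close> depends on the mass and the second moment only, and
    \<open>\<beta>' s / sqrt s\<close> is integrable on \<open>{0<..}\<close>.

  That the quantile coupling is the unique optimal one comes from Hoeffding's formula, which writes the
  cost of a coupling as an integral, over the plane, of a decreasing function of its joint distribution
  function (\<open>transport_cost_defect\<close>, \<open>transport_defect_eq\<close>); the quantile coupling has the largest
  joint distribution function that the marginals permit.

  The potential is a convex function plus \<open>lam / 2 * x\<^sup>2\<close>. This gives a quadratic lower bound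
  for \<open>V\<close>, hence coercivity and, as second moments are continuous in the Wasserstein distance, lower
  semicontinuity; and integrating the convexity inequality of \<open>V\<close> against the optimal coupling gives
  displacement convexity with exactly the term \<open>W2\<^sup>2\<close>.
\<close>


section \<open>Couplings and semicontinuity of integrals\<close>

lemma M2_D:
  assumes "\<rho> \<in> M2 m"
  shows "sets \<rho> = sets borel" "emeasure \<rho> UNIV = ennreal m" "finite_measure \<rho>"
    "(\<integral>\<^sup>+ x. ennreal (x\<^sup>2) \<partial>\<rho>) < \<infinity>" "space \<rho> = UNIV"
proof -
  show s: "sets \<rho> = sets borel" using assms by (auto simp: M2_def)
  show sp: "space \<rho> = UNIV" using sets_eq_imp_space_eq[OF s] by simp
  show "emeasure \<rho> UNIV = ennreal m" "finite_measure \<rho>" "(\<integral>\<^sup>+ x. ennreal (x\<^sup>2) \<partial>\<rho>) < \<infinity>"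
    using assms sp by (auto simp: M2_def intro!: finite_measureI)
qed

lemma couplings_D:
  assumes "\<gamma> \<in> couplings \<rho> \<sigma>"
  shows "sets \<gamma> = sets borel" "sets \<gamma> = sets (borel \<Otimes>\<^sub>M borel)" "distr \<gamma> borel fst = \<rho>" "distr \<gamma> borel snd = \<sigma>"
    "space \<gamma> = UNIV"
proof -
  show s: "sets \<gamma> = sets borel" and "distr \<gamma> borel fst = \<rho>" "distr \<gamma> borel snd = \<sigma>"
    using assms by (auto simp: couplings_def)
  then show "sets \<gamma> = sets (borel \<Otimes>\<^sub>M borel)" by (simp only: borel_prod)
  show "space \<gamma> = UNIV" using sets_eq_imp_space_eq[OF s] by simp
qed

lemma nn_integral_coupling:
  fixes f :: "real \<Rightarrow> ennreal"
  assumes "\<gamma> \<in> couplings \<rho> \<sigma>" and [measurable]: "f \<in> borel_measurable borel"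
  shows "(\<integral>\<^sup>+ x. f x \<partial>\<rho>) = (\<integral>\<^sup>+ z. f (fst z) \<partial>\<gamma>)"
    and "(\<integral>\<^sup>+ x. f x \<partial>\<sigma>) = (\<integral>\<^sup>+ z. f (snd z) \<partial>\<gamma>)"
proof -
  note c = couplings_D[OF assms(1)]
  note [measurable_cong] = c(2)
  show "(\<integral>\<^sup>+ x. f x \<partial>\<rho>) = (\<integral>\<^sup>+ z. f (fst z) \<partial>\<gamma>)"
    unfolding c(3)[symmetric] by (subst nn_integral_distr) auto
  show "(\<integral>\<^sup>+ x. f x \<partial>\<sigma>) = (\<integral>\<^sup>+ z. f (snd z) \<partial>\<gamma>)"
    unfolding c(4)[symmetric] by (subst nn_integral_distr) auto
qed

lemma emeasure_coupling:
  assumes "\<gamma> \<in> couplings \<rho> \<sigma>"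
  shows "emeasure \<gamma> (space \<gamma>) = emeasure \<rho> (space \<rho>)"
  using nn_integral_coupling[OF assms, of "\<lambda>_. 1"] by auto

lemma transport_cost_eq:
  "transport_cost \<gamma> = (\<integral>\<^sup>+ z. ennreal ((fst z - snd z)\<^sup>2) \<partial>\<gamma>)"
  by (simp add: transport_cost_def case_prod_unfold)

text \<open>
  For nonnegative \<open>f\<close> this is the largest \<open>n\<close>-Lipschitz minorant of \<open>f\<close>.
\<close>

definition inf_convolution :: "(real \<Rightarrow> real) \<Rightarrow> nat \<Rightarrow> real \<Rightarrow> real" where
  "inf_convolution f n x = (INF y. f y + real n * \<bar>x - y\<bar>)"

context
  fixes f :: "real \<Rightarrow> real"
  assumes nonneg: "\<And>x. 0 \<le> f x"
begin

lemma inf_convolution_bdd: "bdd_below (range (\<lambda>y. f y + real n * \<bar>x - y\<bar>))"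
  by (rule bdd_belowI2[of _ 0]) (simp add: nonneg)

lemma inf_convolution_le: "inf_convolution f n x \<le> f y + real n * \<bar>x - y\<bar>"
  unfolding inf_convolution_def by (rule cINF_lower[OF inf_convolution_bdd]) simp

lemma inf_convolution_geI: "(\<And>y. c \<le> f y + real n * \<bar>x - y\<bar>) \<Longrightarrow> c \<le> inf_convolution f n x"
  unfolding inf_convolution_def by (rule cINF_greatest) auto

lemma inf_convolution_nonneg: "0 \<le> inf_convolution f n x"
  by (rule inf_convolution_geI) (simp add: nonneg)

lemma inf_convolution_mono: "n \<le> k \<Longrightarrow> inf_convolution f n x \<le> inf_convolution f k x"
proof (rule inf_convolution_geI)
  fix y assume "n \<le> k"
  then have "real n * \<bar>x - y\<bar> \<le> real k * \<bar>x - y\<bar>" by (intro mult_right_mono) auto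
  with inf_convolution_le[of n x y] show "inf_convolution f n x \<le> f y + real k * \<bar>x - y\<bar>" by linarith
qed

lemma inf_convolution_Lipschitz: "inf_convolution f n x \<le> inf_convolution f n z + real n * \<bar>x - z\<bar>"
proof -
  have "inf_convolution f n x - real n * \<bar>x - z\<bar> \<le> inf_convolution f n z"
  proof (rule inf_convolution_geI)
    fix y
    have "real n * \<bar>x - y\<bar> \<le> real n * (\<bar>x - z\<bar> + \<bar>z - y\<bar>)" by (intro mult_left_mono) auto
    with inf_convolution_le[of n x y]
    show "inf_convolution f n x - real n * \<bar>x - z\<bar> \<le> f y + real n * \<bar>z - y\<bar>"
      by (simp add: algebra_simps)
  qed
  then show ?thesis by simp
qed

lemma inf_convolution_measurable [measurable]: "inf_convolution f n \<in> borel_measurable borel"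
proof -
  have "n-lipschitz_on UNIV (inf_convolution f n)"
  proof (rule lipschitz_onI)
    fix x y
    show "dist (inf_convolution f n x) (inf_convolution f n y) \<le> real n * dist x y"
      using inf_convolution_Lipschitz[of n x y] inf_convolution_Lipschitz[of n y x]
      by (simp add: dist_real_def abs_le_iff abs_minus_commute)
  qed simp
  then show ?thesis
    by (intro borel_measurable_continuous_onI lipschitz_on_continuous_on)
qed

text \<open>
  Near \<open>x\<close> the values of \<open>f\<close> exceed any number below \<open>f x\<close>, and away from \<open>x\<close> the penalty
  \<open>n * \<bar>x - y\<bar>\<close> takes over once \<open>n\<close> is large.
\<close>

lemma SUP_inf_convolution:
  assumes lsc: "\<And>a. a < f x \<Longrightarrow> eventually (\<lambda>y. a < f y) (nhds x)"
  shows "(SUP n. ennreal (inf_convolution f n x)) = ennreal (f x)"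
proof (rule antisym)
  show "(SUP n. ennreal (inf_convolution f n x)) \<le> ennreal (f x)"
    using inf_convolution_le[of _ x x] by (intro SUP_least ennreal_leI) simp
  show "ennreal (f x) \<le> (SUP n. ennreal (inf_convolution f n x))"
  proof (rule dense_le)
    fix a assume a: "a < ennreal (f x)"
    then obtain r where r: "a = ennreal r" "0 \<le> r" by (cases a) auto
    with a have "r < f x" by (simp add: ennreal_less_iff)
    from lsc[OF this] obtain d where d: "d > 0" "\<And>y. dist y x < d \<Longrightarrow> r < f y"
      by (auto simp: eventually_nhds_metric)
    obtain n where n: "r / d < real n" using reals_Archimedean2 by blast
    have "r \<le> inf_convolution f n x"
    proof (rule inf_convolution_geI)
      fix y
      show "r \<le> f y + real n * \<bar>x - y\<bar>"
      proof (cases "dist y x < d")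
        case True
        moreover have "0 \<le> real n * \<bar>x - y\<bar>" by simp
        ultimately show ?thesis using d(2)[of y] by linarith
      next
        case False
        have "r \<le> real n * d" using n d(1) by (simp add: field_simps)
        also have "\<dots> \<le> real n * \<bar>x - y\<bar>"
          using False by (intro mult_left_mono) (auto simp: dist_real_def)
        finally show ?thesis using nonneg[of y] by linarith
      qed
    qed
    then have "a \<le> ennreal (inf_convolution f n x)" using r by (simp add: ennreal_leI)
    then show "a \<le> (SUP n. ennreal (inf_convolution f n x))" by (rule order_trans) (rule SUP_upper, simp)
  qed
qed

text \<open>
  Transporting \<open>\<rho>\<close> to \<open>\<sigma>\<close> changes the integral of an \<open>n\<close>-Lipschitz function by at most \<open>n\<close> times the
  \<open>L\<^sup>1\<close> cost, which a small quadratic cost makes small. The general case follows by monotone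
  convergence along the inf-convolutions of \<open>f\<close>. The hypothesis speaks of a single coupling, so the
  result applies before anything is known about optimal ones.
\<close>

lemma nn_integral_lsc:
  assumes lsc: "\<And>x a. a < f x \<Longrightarrow> eventually (\<lambda>y. a < f y) (nhds x)"
    and \<rho>: "\<rho> \<in> M2 m" and a: "a < (\<integral>\<^sup>+ x. ennreal (f x) \<partial>\<rho>)"
  shows "\<exists>\<delta>>0. \<forall>\<sigma>. \<forall>\<gamma>\<in>couplings \<rho> \<sigma>. transport_cost \<gamma> < ennreal (\<delta>\<^sup>2) \<longrightarrow> a < (\<integral>\<^sup>+ x. ennreal (f x) \<partial>\<sigma>)"
proof -
  note M = M2_D[OF \<rho>]
  note [measurable_cong] = M(1)
  let ?g = "\<lambda>n x. ennreal (inf_convolution f n x)"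
  have f_eq: "ennreal (f x) = (SUP n. ?g n x)" for x
    using SUP_inf_convolution[OF lsc] by simp
  have "a < (SUP n. \<integral>\<^sup>+ x. ?g n x \<partial>\<rho>)"
    using a unfolding f_eq
    by (subst nn_integral_monotone_convergence_SUP[symmetric])
       (auto simp: incseq_def le_fun_def intro!: ennreal_leI inf_convolution_mono)
  then obtain n where n: "a < (\<integral>\<^sup>+ x. ?g n x \<partial>\<rho>)" by (auto simp: less_SUP_iff)
  let ?B = "\<integral>\<^sup>+ x. ?g n x \<partial>\<rho>"
  obtain c where c: "c > 0" "a + ennreal c < ?B"
  proof -
    obtain b where b: "a < b" "b < ?B" using n dense by blast
    then obtain ra rb where r: "a = ennreal ra" "b = ennreal rb" "0 \<le> ra" "0 \<le> rb"
      by (cases a; cases b) auto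
    then have "ra < rb" using b(1) by (simp add: ennreal_less_iff)
    then show ?thesis using that[of "rb - ra"] b r by (simp flip: ennreal_plus)
  qed
  define D where "D = real n * (\<bar>m\<bar> + 1) + 1"
  define \<delta> where "\<delta> = c / D"
  have D: "D > 0" by (auto simp: D_def intro!: add_nonneg_pos)
  then have \<delta>: "\<delta> > 0" using c by (simp add: \<delta>_def)
  have "real n * (\<delta> * \<bar>m\<bar> + \<delta>) = D * \<delta> - \<delta>" by (simp add: D_def algebra_simps)
  also have "\<dots> \<le> c" using D \<delta> by (simp add: \<delta>_def)
  finally have \<delta>_le: "real n * (\<delta> * \<bar>m\<bar> + \<delta>) \<le> c" .
  show ?thesis
  proof (intro exI[of _ \<delta>] conjI \<delta> allI ballI impI)
    fix \<sigma> \<gamma> assume \<gamma>: "\<gamma> \<in> couplings \<rho> \<sigma>" and cost: "transport_cost \<gamma> < ennreal (\<delta>\<^sup>2)"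
    note C = couplings_D[OF \<gamma>]
    note [measurable_cong] = C(2)
    have mass: "emeasure \<gamma> UNIV = ennreal m"
      using M(2,5) C(5) emeasure_coupling[OF \<gamma>] by simp
    have "(\<integral>\<^sup>+ z. ennreal \<bar>fst z - snd z\<bar> \<partial>\<gamma>) \<le> (\<integral>\<^sup>+ z. ennreal \<delta> + ennreal (1/\<delta>) * ennreal ((fst z - snd z)\<^sup>2) \<partial>\<gamma>)"
    proof (rule nn_integral_mono)
      fix z :: "real \<times> real"
      have "\<bar>t\<bar> \<le> \<delta> + 1/\<delta> * t\<^sup>2" for t
      proof -
        have "0 \<le> t\<^sup>2 + \<delta>\<^sup>2 - 2 * \<bar>t\<bar> * \<delta>" using zero_le_power2[of "\<bar>t\<bar> - \<delta>"] by (simp add: power2_diff)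
        moreover have "0 \<le> \<bar>t\<bar> * \<delta>" using \<delta> by simp
        ultimately have "\<bar>t\<bar> * \<delta> \<le> \<delta>\<^sup>2 + t\<^sup>2" by linarith
        then have "\<bar>t\<bar> * \<delta> \<le> \<delta> * \<delta> + t\<^sup>2" by (simp add: power2_eq_square)
        then show ?thesis using \<delta> by (simp add: field_simps)
      qed
      then show "ennreal \<bar>fst z - snd z\<bar> \<le> ennreal \<delta> + ennreal (1/\<delta>) * ennreal ((fst z - snd z)\<^sup>2)"
        using \<delta> by (simp flip: ennreal_mult ennreal_plus)
    qed
    also have "\<dots> = ennreal \<delta> * ennreal m + ennreal (1/\<delta>) * transport_cost \<gamma>"
      by (subst nn_integral_add) (auto simp: nn_integral_cmult transport_cost_eq C(5) mass)
    also have "\<dots> \<le> ennreal \<delta> * ennreal \<bar>m\<bar> + ennreal (1/\<delta>) * ennreal (\<delta>\<^sup>2)"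
      using cost \<delta> by (intro add_mono mult_left_mono ennreal_leI) auto
    also have "\<dots> = ennreal (\<delta> * \<bar>m\<bar> + \<delta>)"
      using \<delta> by (simp flip: ennreal_mult ennreal_plus add: power2_eq_square)
    finally have L1: "(\<integral>\<^sup>+ z. ennreal \<bar>fst z - snd z\<bar> \<partial>\<gamma>) \<le> ennreal (\<delta> * \<bar>m\<bar> + \<delta>)" .
    have "?B = (\<integral>\<^sup>+ z. ?g n (fst z) \<partial>\<gamma>)"
      by (rule nn_integral_coupling[OF \<gamma>]) simp
    also have "\<dots> \<le> (\<integral>\<^sup>+ z. ?g n (snd z) + ennreal (real n) * ennreal \<bar>fst z - snd z\<bar> \<partial>\<gamma>)"
      using inf_convolution_Lipschitz
      by (intro nn_integral_mono)
         (auto simp: inf_convolution_nonneg intro!: ennreal_leI simp flip: ennreal_mult ennreal_plus)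
    also have "\<dots> = (\<integral>\<^sup>+ x. ?g n x \<partial>\<sigma>) + ennreal (real n) * (\<integral>\<^sup>+ z. ennreal \<bar>fst z - snd z\<bar> \<partial>\<gamma>)"
      by (subst nn_integral_add) (auto simp: nn_integral_cmult nn_integral_coupling(2)[OF \<gamma>])
    also have "\<dots> \<le> (\<integral>\<^sup>+ x. ennreal (f x) \<partial>\<sigma>) + ennreal (real n) * ennreal (\<delta> * \<bar>m\<bar> + \<delta>)"
      using inf_convolution_le[of n x x for x] L1
      by (intro add_mono nn_integral_mono mult_left_mono ennreal_leI) auto
    also have "\<dots> \<le> (\<integral>\<^sup>+ x. ennreal (f x) \<partial>\<sigma>) + ennreal c"
      using \<delta>_le \<delta> by (subst ennreal_mult[symmetric]) (auto intro!: add_left_mono ennreal_leI)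
    finally have "a + ennreal c < (\<integral>\<^sup>+ x. ennreal (f x) \<partial>\<sigma>) + ennreal c"
      using c(2) by (rule order.strict_trans2[rotated])
    then show "a < (\<integral>\<^sup>+ x. ennreal (f x) \<partial>\<sigma>)"
      by (metis add_right_mono not_le)
  qed
qed

end

text \<open>
  Integrate Young's inequality \<open>y\<^sup>2 \<le> (1 + \<delta>) * x\<^sup>2 + (1 + 1/\<delta>) * (x - y)\<^sup>2\<close> against the coupling.
\<close>

lemma second_moment_usc:
  assumes \<gamma>: "\<gamma> \<in> couplings \<rho> \<sigma>" and cost: "transport_cost \<gamma> \<le> ennreal (\<delta>\<^sup>2)" and \<delta>: "0 < \<delta>" "\<delta> \<le> 1"
    and S: "(\<integral>\<^sup>+ x. ennreal (x\<^sup>2) \<partial>\<rho>) \<le> ennreal S" "0 \<le> S"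
  shows "(\<integral>\<^sup>+ x. ennreal (x\<^sup>2) \<partial>\<sigma>) \<le> ennreal (S + \<delta> * (S + 2))"
proof -
  note C = couplings_D[OF \<gamma>]
  note [measurable_cong] = C(2)
  have "(\<integral>\<^sup>+ x. ennreal (x\<^sup>2) \<partial>\<sigma>) = (\<integral>\<^sup>+ z. ennreal ((snd z)\<^sup>2) \<partial>\<gamma>)"
    by (rule nn_integral_coupling(2)[OF \<gamma>]) simp
  also have "\<dots> \<le> (\<integral>\<^sup>+ z. ennreal (1+\<delta>) * ennreal ((fst z)\<^sup>2) + ennreal (1+1/\<delta>) * ennreal ((fst z - snd z)\<^sup>2) \<partial>\<gamma>)"
  proof (rule nn_integral_mono)
    fix z :: "real \<times> real"
    have "y\<^sup>2 \<le> (1+\<delta>)*x\<^sup>2 + (1+1/\<delta>)*(x-y)\<^sup>2" for x y :: real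
    proof -
      have "(1+\<delta>)*x\<^sup>2 + (1+1/\<delta>)*(x-y)\<^sup>2 - y\<^sup>2 = (\<delta> * x + (x - y))\<^sup>2 / \<delta>"
        using \<delta> by (simp add: field_simps power2_eq_square)
      also have "\<dots> \<ge> 0" using \<delta> by simp
      finally show ?thesis by simp
    qed
    then show "ennreal ((snd z)\<^sup>2) \<le> ennreal (1+\<delta>) * ennreal ((fst z)\<^sup>2) + ennreal (1+1/\<delta>) * ennreal ((fst z - snd z)\<^sup>2)"
      using \<delta> by (simp flip: ennreal_mult ennreal_plus)
  qed
  also have "\<dots> = ennreal (1+\<delta>) * (\<integral>\<^sup>+ x. ennreal (x\<^sup>2) \<partial>\<rho>) + ennreal (1+1/\<delta>) * transport_cost \<gamma>"
    by (subst nn_integral_add) (auto simp: nn_integral_cmult transport_cost_eq nn_integral_coupling(1)[OF \<gamma>])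
  also have "\<dots> \<le> ennreal (1+\<delta>) * ennreal S + ennreal (1+1/\<delta>) * ennreal (\<delta>\<^sup>2)"
    using cost S by (intro add_mono mult_left_mono) auto
  also have "\<dots> = ennreal ((1+\<delta>) * S + (1+1/\<delta>) * \<delta>\<^sup>2)"
    using \<delta> S by (simp flip: ennreal_mult ennreal_plus)
  also have "\<dots> \<le> ennreal (S + \<delta> * (S + 2))"
    using \<delta> S by (intro ennreal_leI) (simp add: field_simps power2_eq_square)
  finally show ?thesis .
qed

section \<open>The mass below a density threshold\<close>

text \<open>
  The dual form of \<open>(\<integral> x. min (u x) s)\<close>, where \<open>u\<close> is the density of the absolutely continuous part
  of \<open>\<rho>\<close>. As an infimum of expressions in \<open>\<rho>\<close> and the Lebesgue measure it involves no
  Lebesgue decomposition.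
\<close>

definition capped_mass :: "real \<Rightarrow> real measure \<Rightarrow> ennreal" where
  "capped_mass s \<rho> = (INF A\<in>sets borel. emeasure \<rho> A + ennreal s * emeasure lborel (- A))"

lemma capped_mass_le_mass:
  assumes "sets \<rho> = sets borel"
  shows "capped_mass s \<rho> \<le> emeasure \<rho> UNIV"
  unfolding capped_mass_def by (rule INF_lower2[of UNIV]) auto

text \<open>
  The optimal set \<open>A\<close> is the region \<open>u \<le> s\<close> without a Lebesgue null set that carries the singular part.
\<close>

lemma capped_mass_eq:
  assumes L: "lebesgue_decomposition \<rho> u \<rho>s" and s: "0 \<le> s"
  shows "capped_mass s \<rho> = (\<integral>\<^sup>+ x. ennreal (min (u x) s) \<partial>lborel)"
proof (rule antisym)
  from L have [measurable]: "u \<in> borel_measurable borel" and u: "\<And>x. 0 \<le> u x"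
    and s_s: "sets \<rho>s = sets borel"
    and \<rho>: "\<And>A. A \<in> sets borel \<Longrightarrow> emeasure \<rho> A = (\<integral>\<^sup>+ x\<in>A. ennreal (u x) \<partial>lborel) + emeasure \<rho>s A"
    by (auto simp: lebesgue_decomposition_def)
  from L obtain N where N [measurable]: "N \<in> sets borel" and N0: "emeasure lborel N = 0" "emeasure \<rho>s (- N) = 0"
    by (auto simp: lebesgue_decomposition_def)
  show "capped_mass s \<rho> \<le> (\<integral>\<^sup>+ x. ennreal (min (u x) s) \<partial>lborel)"
  proof -
    define A where "A = {x. u x \<le> s} - N"
    have A [measurable]: "A \<in> sets borel" by (simp add: A_def)
    have "emeasure \<rho>s A \<le> emeasure \<rho>s (- N)" using s_s by (intro emeasure_mono) (auto simp: A_def)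
    then have A0: "emeasure \<rho>s A = 0" using N0 by simp
    have "emeasure lborel (- A) \<le> emeasure lborel ({x. s < u x} \<union> N)"
      by (intro emeasure_mono) (auto simp: A_def)
    also have "\<dots> \<le> emeasure lborel {x. s < u x} + emeasure lborel N"
      by (intro emeasure_subadditive) auto
    finally have l: "emeasure lborel (- A) \<le> emeasure lborel {x. s < u x}" using N0 by simp
    have "capped_mass s \<rho> \<le> emeasure \<rho> A + ennreal s * emeasure lborel (- A)"
      unfolding capped_mass_def by (rule INF_lower) simp
    also have "\<dots> \<le> (\<integral>\<^sup>+ x\<in>A. ennreal (u x) \<partial>lborel) + ennreal s * emeasure lborel {x. s < u x}"
      using l A0 by (intro add_mono mult_left_mono) (auto simp: \<rho>)
    also have "\<dots> = (\<integral>\<^sup>+ x. ennreal (u x) * indicator A x + ennreal s * indicator {x. s < u x} x \<partial>lborel)"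
      by (subst nn_integral_add) (auto simp: nn_integral_cmult)
    also have "\<dots> \<le> (\<integral>\<^sup>+ x. ennreal (min (u x) s) \<partial>lborel)"
      by (intro nn_integral_mono) (auto simp: A_def indicator_def min_def)
    finally show ?thesis .
  qed
  show "(\<integral>\<^sup>+ x. ennreal (min (u x) s) \<partial>lborel) \<le> capped_mass s \<rho>"
    unfolding capped_mass_def
  proof (rule INF_greatest)
    fix A :: "real set" assume A [measurable]: "A \<in> sets borel"
    have "(\<integral>\<^sup>+ x. ennreal (min (u x) s) \<partial>lborel) \<le> (\<integral>\<^sup>+ x. ennreal (u x) * indicator A x + ennreal s * indicator (- A) x \<partial>lborel)"
      by (intro nn_integral_mono) (auto simp: indicator_def intro!: ennreal_leI)
    also have "\<dots> = (\<integral>\<^sup>+ x\<in>A. ennreal (u x) \<partial>lborel) + ennreal s * emeasure lborel (- A)"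
      by (subst nn_integral_add) (auto simp: nn_integral_cmult)
    also have "\<dots> \<le> emeasure \<rho> A + ennreal s * emeasure lborel (- A)"
      by (intro add_right_mono) (simp add: \<rho>)
    finally show "(\<integral>\<^sup>+ x. ennreal (min (u x) s) \<partial>lborel) \<le> emeasure \<rho> A + ennreal s * emeasure lborel (- A)" .
  qed
qed

text \<open>
  Outer regularity of the Lebesgue measure.
\<close>

lemma capped_mass_open:
  assumes \<rho>: "sets \<rho> = sets borel" and s: "0 \<le> s"
  shows "capped_mass s \<rho> = (INF U\<in>{U. open U}. emeasure \<rho> (- U) + ennreal s * emeasure lborel U)"
proof (rule antisym)
  show "capped_mass s \<rho> \<le> (INF U\<in>{U. open U}. emeasure \<rho> (- U) + ennreal s * emeasure lborel U)"
    unfolding capped_mass_def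
    by (intro INF_greatest, rule_tac i="- U" in INF_lower2) auto
  show "(INF U\<in>{U. open U}. emeasure \<rho> (- U) + ennreal s * emeasure lborel U) \<le> capped_mass s \<rho>"
    unfolding capped_mass_def
  proof (rule INF_greatest)
    fix A :: "real set" assume A: "A \<in> sets borel"
    show "(INF U\<in>{U. open U}. emeasure \<rho> (- U) + ennreal s * emeasure lborel U)
        \<le> emeasure \<rho> A + ennreal s * emeasure lborel (- A)"
    proof (rule ennreal_le_epsilon)
      fix e :: real assume e: "0 < e"
      obtain U where U: "open U" "- A \<subseteq> U" "emeasure lborel (U - - A) \<le> ennreal (e / (s + 1))"
        using outer_regular_lborel_le[of "- A" "e / (s + 1)"] A e s by auto
      have "U = - A \<union> (U - - A)" using U by auto
      then have "emeasure lborel U \<le> emeasure lborel (- A) + emeasure lborel (U - - A)"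
        using U A emeasure_subadditive[of "- A" lborel "U - - A"] by auto
      also have "\<dots> \<le> emeasure lborel (- A) + ennreal (e / (s + 1))" using U by (intro add_left_mono)
      finally have "ennreal s * emeasure lborel U \<le> ennreal s * (emeasure lborel (- A) + ennreal (e / (s + 1)))"
        by (intro mult_left_mono) auto
      also have "\<dots> = ennreal s * emeasure lborel (- A) + ennreal (s * (e / (s + 1)))"
        using s e by (simp add: distrib_left flip: ennreal_mult)
      also have "\<dots> \<le> ennreal s * emeasure lborel (- A) + ennreal e"
        using s e by (intro add_left_mono ennreal_leI) (simp add: field_simps)
      finally have l: "ennreal s * emeasure lborel U \<le> ennreal s * emeasure lborel (- A) + ennreal e" .
      have "(INF U\<in>{U. open U}. emeasure \<rho> (- U) + ennreal s * emeasure lborel U)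
          \<le> emeasure \<rho> (- U) + ennreal s * emeasure lborel U"
        using U by (intro INF_lower) auto
      also have "\<dots> \<le> emeasure \<rho> A + (ennreal s * emeasure lborel (- A) + ennreal e)"
        using U A \<rho> l by (intro add_mono emeasure_mono) auto
      finally show "(INF U\<in>{U. open U}. emeasure \<rho> (- U) + ennreal s * emeasure lborel U)
          \<le> emeasure \<rho> A + ennreal s * emeasure lborel (- A) + ennreal e"
        by (simp add: add.assoc)
    qed
  qed
qed

lemma measure_closed_usc:
  assumes \<rho>: "\<rho> \<in> M2 m" and U: "open U" and e: "e > 0"
  shows "\<exists>\<delta>>0. \<forall>\<sigma>\<in>M2 m. \<forall>\<gamma>\<in>couplings \<rho> \<sigma>. transport_cost \<gamma> < ennreal (\<delta>\<^sup>2) \<longrightarrow>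
     measure \<sigma> (- U) < measure \<rho> (- U) + e"
proof -
  have compl: "measure \<sigma> (- U) = m' - measure \<sigma> U" if "\<sigma> \<in> M2 m" "m' = measure \<rho> UNIV" for \<sigma> m'
  proof -
    interpret finite_measure \<sigma> using M2_D[OF that(1)] by simp
    have "measure \<sigma> UNIV = measure \<rho> UNIV"
      using M2_D(2)[OF that(1)] M2_D(2)[OF \<rho>] by (simp add: measure_def)
    then show ?thesis
      using finite_measure_compl[of U] M2_D[OF that(1)] U that(2) by (simp add: Compl_eq_Diff_UNIV)
  qed
  have em: "(\<integral>\<^sup>+ x. ennreal (indicator U x) \<partial>\<sigma>) = ennreal (measure \<sigma> U)" if "\<sigma> \<in> M2 m" for \<sigma>
  proof -
    interpret finite_measure \<sigma> using M2_D[OF that(1)] by simp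
    show ?thesis using M2_D(1)[OF that] U by (simp add: ennreal_indicator emeasure_eq_measure)
  qed
  show ?thesis
  \<comment> \<open>In the first case \<open>e\<close> exceeds \<open>measure \<rho> U\<close>, and the bound holds since \<open>\<rho>\<close> and \<open>\<sigma>\<close> have the same mass.\<close>
  proof (cases "measure \<rho> U - e < 0")
    case True
    then have "measure \<sigma> (- U) < measure \<rho> (- U) + e" if "\<sigma> \<in> M2 m" for \<sigma>
      using compl[OF that refl] compl[OF \<rho> refl] measure_nonneg[of \<sigma> U] by linarith
    then show ?thesis by (intro exI[of _ 1]) auto
  next
    case False
    have lsc: "eventually (\<lambda>y. a < (indicator U y :: real)) (nhds x)" if "a < (indicator U x :: real)" for a x
    proof (cases "x \<in> U")
      case True
      then have "eventually (\<lambda>y. y \<in> U) (nhds x)" using U eventually_nhds_in_open by blast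
      then show ?thesis by eventually_elim (use that True in auto)
    next
      case False
      then have "a < 0" using that by simp
      then show ?thesis by (intro always_eventually) (auto simp: indicator_def)
    qed
    have "ennreal (measure \<rho> U - e) < (\<integral>\<^sup>+ x. ennreal (indicator U x) \<partial>\<rho>)"
      using False e by (simp add: em[OF \<rho>] ennreal_less_iff)
    from nn_integral_lsc[OF _ lsc \<rho> this] obtain \<delta> where \<delta>: "\<delta> > 0"
      "\<And>\<sigma> \<gamma>. \<gamma> \<in> couplings \<rho> \<sigma> \<Longrightarrow> transport_cost \<gamma> < ennreal (\<delta>\<^sup>2) \<Longrightarrow>
          ennreal (measure \<rho> U - e) < (\<integral>\<^sup>+ x. ennreal (indicator U x) \<partial>\<sigma>)"
      by auto
    show ?thesis
    proof (intro exI[of _ \<delta>] conjI \<delta>(1) ballI impI)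
      fix \<sigma> \<gamma> assume *: "\<sigma> \<in> M2 m" "\<gamma> \<in> couplings \<rho> \<sigma>" "transport_cost \<gamma> < ennreal (\<delta>\<^sup>2)"
      then have "measure \<rho> U - e < measure \<sigma> U"
        using \<delta>(2)[OF *(2,3)] False by (simp add: em ennreal_less_iff)
      then show "measure \<sigma> (- U) < measure \<rho> (- U) + e"
        using compl[OF *(1) refl] compl[OF \<rho> refl] by simp
    qed
  qed
qed

text \<open>
  For a near-optimal open \<open>U\<close> the mass of the closed set \<open>- U\<close> is upper semicontinuous, while the
  Lebesgue term does not change.
\<close>

lemma capped_mass_usc:
  assumes \<rho>: "\<rho> \<in> M2 m" and s: "0 < s" and c: "capped_mass s \<rho> < c"
  shows "\<exists>\<delta>>0. \<forall>\<sigma>\<in>M2 m. \<forall>\<gamma>\<in>couplings \<rho> \<sigma>. transport_cost \<gamma> < ennreal (\<delta>\<^sup>2) \<longrightarrow> capped_mass s \<sigma> < c"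
proof -
  interpret \<rho>: finite_measure \<rho> using M2_D[OF \<rho>] by simp
  from c obtain U where U: "open U" "emeasure \<rho> (- U) + ennreal s * emeasure lborel U < c"
    using s M2_D(1)[OF \<rho>] by (auto simp: capped_mass_open INF_less_iff)
  have fin: "emeasure lborel U < \<infinity>"
  proof (rule ccontr)
    assume "\<not> ?thesis"
    then have "emeasure lborel U = \<infinity>" by (simp add: not_less top_unique)
    with U s show False by (simp add: ennreal_mult_top)
  qed
  define l where "l = measure lborel U"
  have l: "emeasure lborel U = ennreal l" "0 \<le> l"
    using fin by (auto simp: l_def emeasure_eq_ennreal_measure)
  have "ennreal (measure \<rho> (- U) + s * l) < c"
    using U(2) s l by (simp add: \<rho>.emeasure_eq_measure flip: ennreal_mult ennreal_plus)
  then obtain d where d: "ennreal (measure \<rho> (- U) + s * l) < d" "d < c" using dense by blast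
  then obtain d' where d': "d = ennreal d'" "0 \<le> d'" by (cases d) auto
  define e where "e = d' - (measure \<rho> (- U) + s * l)"
  have "0 \<le> measure \<rho> (- U) + s * l" using s l(2) by simp
  then have e: "e > 0" using d(1) unfolding d'(1) by (simp add: e_def ennreal_less_iff del: ennreal_plus)
  from measure_closed_usc[OF \<rho> U(1) e] obtain \<delta> where \<delta>: "\<delta> > 0"
    "\<And>\<sigma> \<gamma>. \<sigma> \<in> M2 m \<Longrightarrow> \<gamma> \<in> couplings \<rho> \<sigma> \<Longrightarrow> transport_cost \<gamma> < ennreal (\<delta>\<^sup>2) \<Longrightarrow>
        measure \<sigma> (- U) < measure \<rho> (- U) + e" by blast
  show ?thesis
  proof (intro exI[of _ \<delta>] conjI \<delta>(1) ballI impI)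
    fix \<sigma> \<gamma> assume *: "\<sigma> \<in> M2 m" "\<gamma> \<in> couplings \<rho> \<sigma>" "transport_cost \<gamma> < ennreal (\<delta>\<^sup>2)"
    interpret \<sigma>: finite_measure \<sigma> using M2_D[OF *(1)] by simp
    have "capped_mass s \<sigma> \<le> emeasure \<sigma> (- U) + ennreal s * emeasure lborel U"
      using s M2_D(1)[OF *(1)] U(1) by (auto simp: capped_mass_open intro!: INF_lower)
    also have "\<dots> = ennreal (measure \<sigma> (- U) + s * l)"
      using s l by (simp add: \<sigma>.emeasure_eq_measure flip: ennreal_mult ennreal_plus)
    also have "\<dots> \<le> d" unfolding d'(1) using \<delta>(2)[OF *] by (intro ennreal_leI) (simp add: e_def)
    also note \<open>d < c\<close>
    finally show "capped_mass s \<sigma> < c" .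
  qed
qed

section \<open>Concavity along monotone interpolations\<close>

text \<open>
  Since \<open>X\<close> and \<open>Y\<close> are both monotone, one element of \<open>G\<close> nearly realises both infima at once, and
  another one both suprema.
\<close>

lemma monotone_spread:
  fixes X Y :: "'a::linorder \<Rightarrow> real"
  assumes G: "G \<noteq> {}" and X: "mono_on G X" and Y: "mono_on G Y" and pq: "0 < p" "0 < q"
    and L: "\<And>w w'. w \<in> G \<Longrightarrow> w' \<in> G \<Longrightarrow> w \<le> w' \<Longrightarrow> p * (X w' - X w) + q * (Y w' - Y w) \<le> L"
  obtains a b a' b' where "X ` G \<subseteq> {a..b}" "Y ` G \<subseteq> {a'..b'}" "a \<le> b" "a' \<le> b'"
    "p * (b - a) + q * (b' - a') \<le> L"
proof -
  have dX: "\<bar>X w' - X w\<bar> \<le> L / p" and dY: "\<bar>Y w' - Y w\<bar> \<le> L / q" if "w \<in> G" "w' \<in> G" for w w'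
  proof -
    have *: "\<bar>X v' - X v\<bar> \<le> L / p \<and> \<bar>Y v' - Y v\<bar> \<le> L / q" if "v \<in> G" "v' \<in> G" "v \<le> v'" for v v'
    proof -
      have m: "0 \<le> X v' - X v" "0 \<le> Y v' - Y v"
        using mono_onD[OF X that] mono_onD[OF Y that] by auto
      have "0 \<le> p * (X v' - X v)" "0 \<le> q * (Y v' - Y v)"
        using m pq by auto
      with L[OF that] have "p * (X v' - X v) \<le> L" "q * (Y v' - Y v) \<le> L" by linarith+
      with m pq show ?thesis by (simp add: field_simps)
    qed
    show "\<bar>X w' - X w\<bar> \<le> L / p" "\<bar>Y w' - Y w\<bar> \<le> L / q"
      using *[of w w'] *[of w' w] that by (cases "w \<le> w'"; auto simp: abs_minus_commute)+
  qed
  obtain w0 where w0: "w0 \<in> G" using G by auto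
  have bX: "bdd_below (X ` G)" "bdd_above (X ` G)"
    using dX[OF w0] by (auto intro!: bdd_belowI2[of _ "X w0 - L / p"] bdd_aboveI2[of _ _ "X w0 + L / p"] simp: abs_le_iff)
      (smt (verit))+
  have bY: "bdd_below (Y ` G)" "bdd_above (Y ` G)"
    using dY[OF w0] by (auto intro!: bdd_belowI2[of _ "Y w0 - L / q"] bdd_aboveI2[of _ _ "Y w0 + L / q"] simp: abs_le_iff)
      (smt (verit))+
  let ?a = "Inf (X ` G)" and ?b = "Sup (X ` G)" and ?a' = "Inf (Y ` G)" and ?b' = "Sup (Y ` G)"
  have sub: "X ` G \<subseteq> {?a..?b}" "Y ` G \<subseteq> {?a'..?b'}"
    using bX bY by (auto intro: cINF_lower cSUP_upper)
  have le: "?a \<le> ?b" "?a' \<le> ?b'" using sub w0 by (auto dest!: subsetD[OF _ imageI])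
  have "p * (?b - ?a) + q * (?b' - ?a') \<le> L"
  proof (rule field_le_epsilon)
    fix e :: real assume "0 < e"
    define d where "d = e / (2 * (p + q))"
    have "d > 0" "e = d * (2 * (p + q))" using \<open>0 < e\<close> pq by (auto simp: d_def)
    then have d: "d > 0" "e = p * (2 * d) + q * (2 * d)" by (auto simp: algebra_simps)
    obtain w1 where w1: "w1 \<in> G" "X w1 < ?a + d"
      using cInf_lessD[of "X ` G" "?a + d"] G d by auto
    obtain w2 where w2: "w2 \<in> G" "Y w2 < ?a' + d"
      using cInf_lessD[of "Y ` G" "?a' + d"] G d by auto
    obtain v1 where v1: "v1 \<in> G" "?b - d < X v1"
      using less_cSupD[of "X ` G" "?b - d"] G d by auto
    obtain v2 where v2: "v2 \<in> G" "?b' - d < Y v2"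
      using less_cSupD[of "Y ` G" "?b' - d"] G d by auto
    define w v where "w = min (min w1 w2) (max v1 v2)" and "v = max v1 v2"
    have wv: "w \<in> G" "v \<in> G" "w \<le> v" using w1 w2 v1 v2 by (auto simp: w_def v_def min_def max_def)
    have "X w \<le> X w1" "Y w \<le> Y w2" "X v1 \<le> X v" "Y v2 \<le> Y v"
      using w1(1) w2(1) v1(1) v2(1) wv by (auto intro!: mono_onD[OF X] mono_onD[OF Y] simp: w_def v_def min_le_iff_disj)
    then have "?b - ?a - 2 * d \<le> X v - X w" "?b' - ?a' - 2 * d \<le> Y v - Y w"
      using w1 w2 v1 v2 by linarith+
    then have "p * (?b - ?a - 2 * d) + q * (?b' - ?a' - 2 * d) \<le> p * (X v - X w) + q * (Y v - Y w)"
      using pq by (intro add_mono mult_left_mono) auto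
    also have "\<dots> \<le> L" by (rule L[OF wv])
    finally show "p * (?b - ?a) + q * (?b' - ?a') \<le> L + e" using d(2) by (simp add: algebra_simps)
  qed
  then show ?thesis using that sub le by blast
qed

lemma open_real_disjoint_connected:
  fixes U :: "real set"
  assumes "open U"
  obtains K :: "nat \<Rightarrow> real set" where "disjoint_family K" "\<And>i. connected (K i)" "\<And>i. open (K i)" "(\<Union>i. K i) = U"
proof -
  let ?C = "components U"
  have op: "\<And>S. S \<in> ?C \<Longrightarrow> open S" using assms open_components by blast
  have cnt: "countable ?C"
    using op pairwise_disjoint_components[of U]
    by (intro countable_disjoint_open_subsets) (auto simp: pairwise_def disjnt_def)
  \<comment> \<open>Indices that enumerate no component get the empty set, which keeps the family disjoint when there are only finitely many components.\<close>
  define K where "K i = (if i \<in> to_nat_on ?C ` ?C then from_nat_into ?C i else {})" for i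
  have K: "K i = {} \<or> K i \<in> ?C \<and> to_nat_on ?C (K i) = i" for i
    using cnt by (auto simp: K_def)
  show ?thesis
  proof (rule that)
    show "disjoint_family K"
      unfolding disjoint_family_on_def
    proof (intro ballI impI)
      fix i j :: nat assume "i \<noteq> j"
      then show "K i \<inter> K j = {}"
        using K[of i] K[of j] pairwise_disjoint_components[of U] unfolding pairwise_def by (metis Int_empty_left Int_empty_right)
    qed
    show "connected (K i)" "open (K i)" for i
      using K[of i] op in_components_connected by auto
    have "S \<subseteq> (\<Union>i. K i)" if "S \<in> ?C" for S
      using that cnt by (intro SUP_upper2[of "to_nat_on ?C S"]) (auto simp: K_def)
    then show "(\<Union>i. K i) = U"
      using K Union_components[of U] by (intro equalityI) (blast, metis Sup_least)
  qed
qed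

text \<open>
  Given an open \<open>U\<close> for the interpolated measure, each component \<open>K\<close> of \<open>U\<close> contains the values of \<open>Z\<close>
  on a set of levels over which \<open>X\<close> and \<open>Y\<close> range in intervals \<open>P\<close> and \<open>Q\<close>, with weighted lengths that
  add up to at most the length of \<open>K\<close> by \<open>monotone_spread\<close>. The union of the \<open>P\<close>, and that of the
  \<open>Q\<close>, are the competitors for the two endpoints: levels whose \<open>X\<close> avoids every \<open>P\<close> have \<open>Z\<close> outside \<open>U\<close>.
\<close>

lemma capped_mass_concave:
  fixes X Y :: "real \<Rightarrow> real"
  assumes X: "mono_on (space \<mu>) X" and Y: "mono_on (space \<mu>) Y"
    and [measurable]: "X \<in> borel_measurable \<mu>" "Y \<in> borel_measurable \<mu>"
    and \<theta>: "0 < \<theta>" "\<theta> < 1" and s: "0 < s"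
  shows "ennreal (1 - \<theta>) * capped_mass s (distr \<mu> borel X) + ennreal \<theta> * capped_mass s (distr \<mu> borel Y)
    \<le> capped_mass s (distr \<mu> borel (\<lambda>w. (1 - \<theta>) * X w + \<theta> * Y w))"
proof -
  define Z where "Z w = (1 - \<theta>) * X w + \<theta> * Y w" for w
  have [measurable]: "Z \<in> borel_measurable \<mu>" unfolding Z_def by measurable
  have "ennreal (1 - \<theta>) * capped_mass s (distr \<mu> borel X) + ennreal \<theta> * capped_mass s (distr \<mu> borel Y)
     \<le> emeasure (distr \<mu> borel Z) (- U) + ennreal s * emeasure lborel U" if "open U" for U
  proof (cases "emeasure lborel U = \<infinity>")
    case True
    then show ?thesis using s by (simp add: ennreal_mult_top)
  next
    case False
    obtain K :: "nat \<Rightarrow> real set" where K: "disjoint_family K" "\<And>i. connected (K i)" "\<And>i. open (K i)" "(\<Union>i. K i) = U"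
      by (rule open_real_disjoint_connected[OF \<open>open U\<close>]) blast
    have Kfin: "emeasure lborel (K i) < \<infinity>" for i
    proof -
      have "emeasure lborel (K i) \<le> emeasure lborel U" using K(3,4) \<open>open U\<close> by (intro emeasure_mono) auto
      with False show ?thesis by (simp add: less_top[symmetric] top_unique) (metis neq_top_trans)
    qed
    define G where "G i = {w \<in> space \<mu>. Z w \<in> K i}" for i
    have "\<exists>P Q. P \<in> sets borel \<and> Q \<in> sets borel \<and> X ` G i \<subseteq> P \<and> Y ` G i \<subseteq> Q \<and>
        ennreal (1 - \<theta>) * emeasure lborel P + ennreal \<theta> * emeasure lborel Q \<le> emeasure lborel (K i)" for i
    proof (cases "G i = {}")
      case True
      then show ?thesis by (intro exI[of _ "{}"]) auto
    next
      case ne: False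
      have Gs: "G i \<subseteq> space \<mu>" by (auto simp: G_def)
      have "(1 - \<theta>) * (X w' - X w) + \<theta> * (Y w' - Y w) \<le> measure lborel (K i)"
        if w: "w \<in> G i" "w' \<in> G i" "w \<le> w'" for w w'
      proof -
        have "X w \<le> X w'" "Y w \<le> Y w'" using w Gs by (auto intro!: mono_onD[OF X] mono_onD[OF Y])
        then have "Z w \<le> Z w'" using \<theta> by (auto simp: Z_def intro!: add_mono mult_left_mono)
        moreover have "{Z w..Z w'} \<subseteq> K i"
          using K(2)[of i] w by (auto simp: G_def intro: connected_contains_Icc[THEN subsetD])
        then have "emeasure lborel {Z w..Z w'} \<le> emeasure lborel (K i)" using K(3) by (intro emeasure_mono) auto
        ultimately have "ennreal (Z w' - Z w) \<le> ennreal (measure lborel (K i))"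
          using Kfin[of i] by (simp add: emeasure_eq_ennreal_measure)
        then have "Z w' - Z w \<le> measure lborel (K i)" by (simp add: ennreal_le_iff)
        then show ?thesis by (simp add: Z_def algebra_simps)
      qed
      note spread = this
      obtain a b a' b' where ab: "X ` G i \<subseteq> {a..b}" "Y ` G i \<subseteq> {a'..b'}" "a \<le> b" "a' \<le> b'"
        "(1 - \<theta>) * (b - a) + \<theta> * (b' - a') \<le> measure lborel (K i)"
        by (rule monotone_spread[OF ne mono_on_subset[OF X Gs] mono_on_subset[OF Y Gs] _ _ spread]) (use \<theta> in auto)
      have "ennreal (1 - \<theta>) * emeasure lborel {a..b} + ennreal \<theta> * emeasure lborel {a'..b'}
          = ennreal ((1 - \<theta>) * (b - a) + \<theta> * (b' - a'))"
        using \<theta> ab(3,4) by (simp flip: ennreal_mult ennreal_plus)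
      also have "\<dots> \<le> emeasure lborel (K i)"
        using ab(5) Kfin[of i] by (simp add: emeasure_eq_ennreal_measure ennreal_leI)
      finally show ?thesis using ab(1,2) by (intro exI[of _ "{a..b}"] exI[of _ "{a'..b'}"]) auto
    qed
    then obtain P Q where PQ: "\<And>i. P i \<in> sets borel" "\<And>i. Q i \<in> sets borel" "\<And>i. X ` G i \<subseteq> P i" "\<And>i. Y ` G i \<subseteq> Q i"
      "\<And>i. ennreal (1 - \<theta>) * emeasure lborel (P i) + ennreal \<theta> * emeasure lborel (Q i) \<le> emeasure lborel (K i)"
      by metis
    have cap: "capped_mass s (distr \<mu> borel T) \<le> emeasure (distr \<mu> borel Z) (- U) + ennreal s * (\<Sum>i. emeasure lborel (R i))"
      if [measurable]: "T \<in> borel_measurable \<mu>" and R: "\<And>i. R i \<in> sets borel" "\<And>i. T ` G i \<subseteq> R i" for T R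
    proof -
      define S where "S = (\<Union>i. R i)"
      have [measurable]: "S \<in> sets borel" "U \<in> sets borel" using R \<open>open U\<close> by (auto simp: S_def)
      have "capped_mass s (distr \<mu> borel T) \<le> emeasure (distr \<mu> borel T) (- S) + ennreal s * emeasure lborel S"
        unfolding capped_mass_def by (rule INF_lower2[of "- S"]) auto
      also have "emeasure (distr \<mu> borel T) (- S) \<le> emeasure (distr \<mu> borel Z) (- U)"
      proof -
        have "T -` (- S) \<inter> space \<mu> \<subseteq> Z -` (- U) \<inter> space \<mu>"
          using R(2) K(4) by (fastforce simp: G_def S_def)
        then show ?thesis by (simp add: emeasure_distr emeasure_mono)
      qed
      also have "emeasure lborel S \<le> (\<Sum>i. emeasure lborel (R i))"
        unfolding S_def using R by (intro emeasure_subadditive_countably) auto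
      finally show ?thesis by (simp add: add_mono mult_left_mono)
    qed
    have split: "ennreal (1 - \<theta>) * (a + b) + ennreal \<theta> * (a + b') = a + (ennreal (1 - \<theta>) * b + ennreal \<theta> * b')" for a b b'
    proof -
      have "ennreal (1 - \<theta>) * a + ennreal \<theta> * a = a"
        using \<theta> by (simp flip: distrib_right ennreal_plus)
      moreover have "ennreal (1 - \<theta>) * (a + b) + ennreal \<theta> * (a + b')
          = (ennreal (1 - \<theta>) * a + ennreal \<theta> * a) + (ennreal (1 - \<theta>) * b + ennreal \<theta> * b')"
        by (simp only: distrib_left add_ac)
      ultimately show ?thesis by simp
    qed
    have "ennreal (1 - \<theta>) * capped_mass s (distr \<mu> borel X) + ennreal \<theta> * capped_mass s (distr \<mu> borel Y)
       \<le> ennreal (1 - \<theta>) * (emeasure (distr \<mu> borel Z) (- U) + ennreal s * (\<Sum>i. emeasure lborel (P i)))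
        + ennreal \<theta> * (emeasure (distr \<mu> borel Z) (- U) + ennreal s * (\<Sum>i. emeasure lborel (Q i)))"
      using PQ by (intro add_mono mult_left_mono cap) auto
    also have "\<dots> = emeasure (distr \<mu> borel Z) (- U) +
        ennreal s * (\<Sum>i. ennreal (1 - \<theta>) * emeasure lborel (P i) + ennreal \<theta> * emeasure lborel (Q i))"
      unfolding split by (simp add: distrib_left mult.left_commute flip: suminf_add)
    also have "\<dots> \<le> emeasure (distr \<mu> borel Z) (- U) + ennreal s * (\<Sum>i. emeasure lborel (K i))"
      using PQ(5) by (intro add_left_mono mult_left_mono suminf_le) auto
    also have "(\<Sum>i. emeasure lborel (K i)) = emeasure lborel U"
      using K by (subst suminf_emeasure) auto
    finally show ?thesis .
  qed
  then show ?thesis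
    using s unfolding Z_def[symmetric] by (auto simp: capped_mass_open[of "distr \<mu> borel Z"] intro!: INF_greatest)
qed

section \<open>The optimal coupling on the line\<close>

definition quantile :: "real measure \<Rightarrow> real \<Rightarrow> real" where
  "quantile \<rho> w = Inf {x. w \<le> cdf \<rho> x}"

text \<open>
  The common parameter space of all quantile functions of measures of mass \<open>m\<close>.
\<close>

abbreviation levels :: "real \<Rightarrow> real measure" where
  "levels m \<equiv> restrict_space lborel {0<..<m}"

definition quantile_coupling :: "real \<Rightarrow> real measure \<Rightarrow> real measure \<Rightarrow> (real \<times> real) measure" where
  "quantile_coupling m \<rho> \<sigma> = distr (levels m) borel (\<lambda>w. (quantile \<rho> w, quantile \<sigma> w))"

lemma M2_finite_borel_measure: "\<rho> \<in> M2 m \<Longrightarrow> finite_borel_measure \<rho>"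
  using M2_D[of \<rho> m] by (simp add: finite_borel_measure_def finite_borel_measure_axioms_def)

lemma M2_measure: "\<rho> \<in> M2 m \<Longrightarrow> 0 < m \<Longrightarrow> measure \<rho> UNIV = m"
  using M2_D(2)[of \<rho> m] by (simp add: measure_def)

context
  fixes m :: real and \<rho> :: "real measure"
  assumes \<rho>: "\<rho> \<in> M2 m" and m: "0 < m"
begin

interpretation finite_borel_measure \<rho> by (rule M2_finite_borel_measure[OF \<rho>])

lemma cdf_le_mass: "cdf \<rho> x \<le> m"
  using cdf_bounded[of x] M2_measure[OF \<rho> m] M2_D(5)[OF \<rho>] by simp

interpretation right_continuous_mono "cdf \<rho>" 0 m
  using cdf_lim_at_top cdf_is_right_cont cdf_lim_at_bot cdf_nondecreasing M2_measure[OF \<rho> m] M2_D(5)[OF \<rho>]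
  by unfold_locales (auto intro: monoI)

lemma quantile_le_iff: "w \<in> {0<..<m} \<Longrightarrow> quantile \<rho> w \<le> x \<longleftrightarrow> w \<le> cdf \<rho> x"
  using pseudoinverse[of w x] by (simp add: quantile_def)

lemma mono_on_quantile: "mono_on {0<..<m} (quantile \<rho>)"
  using mono_I by (simp add: quantile_def[abs_def])

lemma quantile_measurable: "quantile \<rho> \<in> borel_measurable (levels m)"
  using borel_measurable_mono_on_fnc[OF mono_on_quantile]
  by (simp add: measurable_cong_sets[OF sets_restrict_space_cong[OF sets_lborel] refl])

end

lemma finite_measure_levels: "0 < m \<Longrightarrow> finite_measure (levels m)"
  by (intro finite_measureI) (simp add: emeasure_restrict_space space_restrict_space)

lemma emeasure_levels:
  assumes "0 \<le> c" "c \<le> m"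
  shows "emeasure (levels m) {w \<in> {0<..<m}. w \<le> c} = ennreal c"
proof -
  have eq: "{w \<in> {0<..<m}. w \<le> c} = (if c = m then {0<..<m} else {0<..c})"
    using assms by auto
  have "emeasure (levels m) {w \<in> {0<..<m}. w \<le> c} = emeasure lborel {w \<in> {0<..<m}. w \<le> c}"
    by (intro emeasure_restrict_space) auto
  then show ?thesis using assms unfolding eq by (cases "c = m") simp_all
qed

lemma measure_eqI_quadrants:
  fixes \<mu> \<nu> :: "(real \<times> real) measure"
  assumes s: "sets \<mu> = sets borel" "sets \<nu> = sets borel" and fin: "finite_measure \<mu>"
    and eq: "\<And>a b. emeasure \<mu> ({..a} \<times> {..b}) = emeasure \<nu> ({..a} \<times> {..b})"
  shows "\<mu> = \<nu>"
proof (rule measure_eqI_generator_eq[where \<Omega>=UNIV and E="range (\<lambda>a::real \<times> real. {..a})" and A="\<lambda>i. {..(real i, real i)}"])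
  have q: "{..p} = {..fst p} \<times> {..snd p}" for p :: "real \<times> real"
    by (auto simp: less_eq_prod_def)
  show "Int_stable (range (\<lambda>a::real \<times> real. {..a}))"
  proof (rule Int_stableI)
    fix X Y assume "X \<in> range (\<lambda>a::real \<times> real. {..a})" "Y \<in> range (\<lambda>a::real \<times> real. {..a})"
    then obtain a b where "X = {..a}" "Y = {..b}" by auto
    then have "X \<inter> Y = {..inf a b}" by auto
    then show "X \<inter> Y \<in> range (\<lambda>a::real \<times> real. {..a})" by blast
  qed
  show "emeasure \<mu> X = emeasure \<nu> X" if "X \<in> range (\<lambda>a::real \<times> real. {..a})" for X
    using that eq by (auto simp: q)
  have "sets (borel :: (real \<times> real) measure) = sigma_sets UNIV (range (\<lambda>a. {..a}))"
    unfolding borel_eq_atMost by (rule sets_measure_of) auto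
  then show "sets \<mu> = sigma_sets UNIV (range (\<lambda>a. {..a}))" "sets \<nu> = sigma_sets UNIV (range (\<lambda>a. {..a}))"
    using s by auto
  show "(\<Union>i. {..(real i, real i)}) = UNIV"
  proof (intro equalityI subsetI)
    fix p :: "real \<times> real"
    obtain n where "max (fst p) (snd p) \<le> real n" using real_arch_simple by blast
    then show "p \<in> (\<Union>i. {..(real i, real i)})" by (auto simp: less_eq_prod_def intro!: exI[of _ n])
  qed simp
  show "emeasure \<mu> {..(real i, real i)} \<noteq> \<infinity>" for i
    using fin by (simp add: finite_measure.emeasure_finite)
qed auto

lemma quantile_coupling_quadrant:
  assumes \<rho>: "\<rho> \<in> M2 m" and \<sigma>: "\<sigma> \<in> M2 m" and m: "0 < m"
  shows "emeasure (quantile_coupling m \<rho> \<sigma>) ({..a} \<times> {..b}) = ennreal (min (cdf \<rho> a) (cdf \<sigma> b))"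
proof -
  note [measurable] = quantile_measurable[OF \<rho> m] quantile_measurable[OF \<sigma> m]
  have "emeasure (quantile_coupling m \<rho> \<sigma>) ({..a} \<times> {..b})
      = emeasure (levels m) ((\<lambda>w. (quantile \<rho> w, quantile \<sigma> w)) -` ({..a} \<times> {..b}) \<inter> space (levels m))"
    unfolding quantile_coupling_def by (rule emeasure_distr) (auto intro!: borel_closed closed_Times)
  also have "(\<lambda>w. (quantile \<rho> w, quantile \<sigma> w)) -` ({..a} \<times> {..b}) \<inter> space (levels m)
      = {w \<in> {0<..<m}. w \<le> min (cdf \<rho> a) (cdf \<sigma> b)}"
    by (auto simp: quantile_le_iff[OF \<rho> m] quantile_le_iff[OF \<sigma> m] space_restrict_space)
  also have "emeasure (levels m) \<dots> = ennreal (min (cdf \<rho> a) (cdf \<sigma> b))"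
    using cdf_le_mass[OF \<rho> m] by (intro emeasure_levels) (auto simp: min_le_iff_disj cdf_def)
  finally show ?thesis .
qed

lemma distr_quantile:
  assumes \<rho>: "\<rho> \<in> M2 m" and m: "0 < m"
  shows "distr (levels m) borel (quantile \<rho>) = \<rho>"
proof (rule cdf_unique')
  note [measurable] = quantile_measurable[OF \<rho> m]
  show "finite_borel_measure (distr (levels m) borel (quantile \<rho>))"
    using finite_measure_levels[OF m]
    by (auto simp: finite_borel_measure_def finite_borel_measure_axioms_def intro: finite_measure.finite_measure_distr)
  show "finite_borel_measure \<rho>" by (rule M2_finite_borel_measure[OF \<rho>])
  show "cdf (distr (levels m) borel (quantile \<rho>)) = cdf \<rho>"
  proof
    fix a
    have "emeasure (distr (levels m) borel (quantile \<rho>)) {..a}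
        = emeasure (levels m) (quantile \<rho> -` {..a} \<inter> space (levels m))"
      by (rule emeasure_distr) auto
    also have "quantile \<rho> -` {..a} \<inter> space (levels m) = {w \<in> {0<..<m}. w \<le> cdf \<rho> a}"
      by (auto simp: quantile_le_iff[OF \<rho> m] space_restrict_space)
    also have "emeasure (levels m) \<dots> = ennreal (cdf \<rho> a)"
      using cdf_le_mass[OF \<rho> m] by (intro emeasure_levels) (auto simp: cdf_def)
    finally show "cdf (distr (levels m) borel (quantile \<rho>)) a = cdf \<rho> a"
      by (simp add: cdf_def measure_def)
  qed
qed

lemma quantile_coupling_in_couplings:
  assumes \<rho>: "\<rho> \<in> M2 m" and \<sigma>: "\<sigma> \<in> M2 m" and m: "0 < m"
  shows "quantile_coupling m \<rho> \<sigma> \<in> couplings \<rho> \<sigma>"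
proof -
  note [measurable] = quantile_measurable[OF \<rho> m] quantile_measurable[OF \<sigma> m]
  have "distr (quantile_coupling m \<rho> \<sigma>) borel fst = \<rho>" "distr (quantile_coupling m \<rho> \<sigma>) borel snd = \<sigma>"
    unfolding quantile_coupling_def
    using distr_quantile[OF \<rho> m] distr_quantile[OF \<sigma> m]
    by (simp_all add: distr_distr comp_def borel_prod[symmetric])
  then show ?thesis by (simp add: couplings_def quantile_coupling_def)
qed

definition joint_cdf :: "(real \<times> real) measure \<Rightarrow> real \<Rightarrow> real \<Rightarrow> real" where
  "joint_cdf \<gamma> a b = measure \<gamma> ({..a} \<times> {..b})"

text \<open>
  The mass that the coupling carries from one side of the interval spanned by the coordinates of \<open>p\<close>
  to the other, in both directions.
\<close>

definition transport_defect :: "(real \<times> real) measure \<Rightarrow> real \<times> real \<Rightarrow> ennreal" where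
  "transport_defect \<gamma> p =
     emeasure \<gamma> {z. snd z \<le> min (fst p) (snd p) \<and> max (fst p) (snd p) < fst z} +
     emeasure \<gamma> {z. fst z \<le> min (fst p) (snd p) \<and> max (fst p) (snd p) < snd z}"

text \<open>
  Hoeffding's formula: \<open>(x - y)\<^sup>2\<close> is the area of the square with side \<open>{y..<x}\<close> or \<open>{x..<y}\<close>, and
  Tonelli's theorem exchanges the area integral with the coupling.
\<close>

lemma transport_cost_defect:
  assumes s: "sets \<gamma> = sets borel" and fin: "finite_measure \<gamma>"
  shows "transport_cost \<gamma> = (\<integral>\<^sup>+ p. transport_defect \<gamma> p \<partial>(lborel \<Otimes>\<^sub>M lborel))"
    and "transport_defect \<gamma> \<in> borel_measurable (lborel \<Otimes>\<^sub>M lborel)"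
proof -
  interpret \<gamma>: finite_measure \<gamma> by (rule fin)
  interpret L2: pair_sigma_finite "lborel :: real measure" "lborel :: real measure" ..
  interpret P: pair_sigma_finite \<gamma> "lborel \<Otimes>\<^sub>M lborel :: (real \<times> real) measure" ..
  have s2: "sets \<gamma> = sets (borel \<Otimes>\<^sub>M borel)" using s by (simp only: borel_prod)
  note [measurable_cong] = s2
  have sp: "space \<gamma> = UNIV" using sets_eq_imp_space_eq[OF s] by simp
  define A where "A z p \<longleftrightarrow> snd z \<le> min (fst p) (snd p) \<and> max (fst p) (snd p) < fst z" for z p :: "real \<times> real"
  define B where "B z p \<longleftrightarrow> fst z \<le> min (fst p) (snd p) \<and> max (fst p) (snd p) < snd z" for z p :: "real \<times> real"
  define k where "k z p = (indicator {p. A z p} p + indicator {p. B z p} p :: ennreal)" for z p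
  have k_alt: "k z p = (if A z p then 1 else 0) + (if B z p then 1 else 0)" for z p
    by (simp add: k_def)
  have k_meas [measurable]: "case_prod k \<in> borel_measurable (\<gamma> \<Otimes>\<^sub>M (lborel \<Otimes>\<^sub>M lborel))"
    unfolding k_alt A_def B_def case_prod_unfold by measurable
  have inner_coupling: "(\<integral>\<^sup>+ z. k z p \<partial>\<gamma>) = transport_defect \<gamma> p" for p
  proof -
    have "{z \<in> space \<gamma>. A z p} \<in> sets \<gamma>" "{z \<in> space \<gamma>. B z p} \<in> sets \<gamma>"
      unfolding A_def B_def by measurable
    then have [measurable]: "{z. A z p} \<in> sets \<gamma>" "{z. B z p} \<in> sets \<gamma>" by (simp_all add: sp)
    have "(\<integral>\<^sup>+ z. k z p \<partial>\<gamma>) = (\<integral>\<^sup>+ z. indicator {z. A z p} z + indicator {z. B z p} z \<partial>\<gamma>)"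
      by (intro nn_integral_cong) (simp add: k_def indicator_def)
    also have "\<dots> = emeasure \<gamma> {z. A z p} + emeasure \<gamma> {z. B z p}"
      by (subst nn_integral_add) auto
    finally show ?thesis by (simp add: transport_defect_def A_def B_def)
  qed
  have inner_area: "(\<integral>\<^sup>+ p. k z p \<partial>(lborel \<Otimes>\<^sub>M lborel)) = ennreal ((fst z - snd z)\<^sup>2)" for z
  proof -
    have eq: "{p. A z p} = {snd z..<fst z} \<times> {snd z..<fst z}" "{p. B z p} = {fst z..<snd z} \<times> {fst z..<snd z}"
      by (auto simp: A_def B_def)
    have "(\<integral>\<^sup>+ p. k z p \<partial>(lborel \<Otimes>\<^sub>M lborel))
       = emeasure (lborel \<Otimes>\<^sub>M lborel) ({snd z..<fst z} \<times> {snd z..<fst z}) + emeasure (lborel \<Otimes>\<^sub>M lborel) ({fst z..<snd z} \<times> {fst z..<snd z})"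
      unfolding k_def eq by (subst nn_integral_add) auto
    also have "\<dots> = ennreal ((fst z - snd z)\<^sup>2)"
      by (cases "fst z \<le> snd z")
         (auto simp: lborel.emeasure_pair_measure_Times power2_eq_square algebra_simps simp flip: ennreal_mult)
    finally show ?thesis .
  qed
  have "transport_cost \<gamma> = (\<integral>\<^sup>+ z. (\<integral>\<^sup>+ p. k z p \<partial>(lborel \<Otimes>\<^sub>M lborel)) \<partial>\<gamma>)"
    unfolding inner_area transport_cost_eq ..
  also have "\<dots> = (\<integral>\<^sup>+ p. (\<integral>\<^sup>+ z. k z p \<partial>\<gamma>) \<partial>(lborel \<Otimes>\<^sub>M lborel))"
    by (rule P.Fubini'[symmetric]) (rule k_meas)
  finally show "transport_cost \<gamma> = (\<integral>\<^sup>+ p. transport_defect \<gamma> p \<partial>(lborel \<Otimes>\<^sub>M lborel))"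
    unfolding inner_coupling .
  have "(\<lambda>p. \<integral>\<^sup>+ z. k z p \<partial>\<gamma>) \<in> borel_measurable (lborel \<Otimes>\<^sub>M lborel)"
    by (intro \<gamma>.borel_measurable_nn_integral) (unfold k_alt A_def B_def case_prod_unfold, measurable)
  then show "transport_defect \<gamma> \<in> borel_measurable (lborel \<Otimes>\<^sub>M lborel)"
    unfolding inner_coupling by simp
qed

context
  fixes m :: real and \<rho> \<sigma> :: "real measure" and \<gamma>
  assumes \<rho>: "\<rho> \<in> M2 m" and \<gamma>: "\<gamma> \<in> couplings \<rho> \<sigma>"
begin

lemma finite_measure_coupling: "finite_measure \<gamma>"
  using emeasure_coupling[OF \<gamma>] M2_D(2,5)[OF \<rho>] by (intro finite_measureI) simp

interpretation finite_measure \<gamma> by (rule finite_measure_coupling)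

lemma measure_marginals:
  assumes "A \<in> sets borel"
  shows "measure \<rho> A = measure \<gamma> (A \<times> UNIV)" "measure \<sigma> A = measure \<gamma> (UNIV \<times> A)"
proof -
  note C = couplings_D[OF \<gamma>]
  note [measurable_cong] = C(2)
  have "measure \<rho> A = measure \<gamma> (fst -` A \<inter> space \<gamma>)" "measure \<sigma> A = measure \<gamma> (snd -` A \<inter> space \<gamma>)"
    unfolding C(3)[symmetric] C(4)[symmetric] using assms by (auto intro!: measure_distr)
  moreover have "fst -` A \<inter> space \<gamma> = A \<times> UNIV" "snd -` A \<inter> space \<gamma> = UNIV \<times> A" using C(5) by auto
  ultimately show "measure \<rho> A = measure \<gamma> (A \<times> UNIV)" "measure \<sigma> A = measure \<gamma> (UNIV \<times> A)" by simp_all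
qed

lemma Times_in_coupling [measurable]: "A \<in> sets borel \<Longrightarrow> B \<in> sets borel \<Longrightarrow> A \<times> B \<in> sets \<gamma>"
  using couplings_D(2)[OF \<gamma>] by simp

lemma joint_cdf_le: "joint_cdf \<gamma> a b \<le> min (cdf \<rho> a) (cdf \<sigma> b)"
  unfolding joint_cdf_def cdf_def measure_marginals[OF borel_closed[OF closed_atMost]]
  by (auto intro!: finite_measure_mono)

lemma joint_cdf_mono: "a \<le> a' \<Longrightarrow> b \<le> b' \<Longrightarrow> joint_cdf \<gamma> a b \<le> joint_cdf \<gamma> a' b'"
  unfolding joint_cdf_def by (intro finite_measure_mono) auto

text \<open>
  With the marginals given, the defect depends on the coupling through its joint distribution
  function only, and decreases in it.
\<close>

lemma transport_defect_eq:
  "transport_defect \<gamma> p =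
     ennreal (cdf \<sigma> (min (fst p) (snd p)) - joint_cdf \<gamma> (max (fst p) (snd p)) (min (fst p) (snd p)) +
       (cdf \<rho> (min (fst p) (snd p)) - joint_cdf \<gamma> (min (fst p) (snd p)) (max (fst p) (snd p))))"
proof -
  have "measure \<gamma> {z. snd z \<le> c \<and> d < fst z} = cdf \<sigma> c - joint_cdf \<gamma> d c" for c d
  proof -
    have "{z. snd z \<le> c \<and> d < fst z} = UNIV \<times> {..c} - {..d} \<times> {..c}" by auto
    then show ?thesis
      by (simp add: joint_cdf_def cdf_def measure_marginals(2) finite_measure_Diff)
         (subst finite_measure_Diff, auto)
  qed
  moreover have "measure \<gamma> {z. fst z \<le> c \<and> d < snd z} = cdf \<rho> c - joint_cdf \<gamma> c d" for c d
  proof -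
    have "{z. fst z \<le> c \<and> d < snd z} = {..c} \<times> UNIV - {..c} \<times> {..d}" by auto
    then show ?thesis
      by (simp add: joint_cdf_def cdf_def measure_marginals(1) finite_measure_Diff)
         (subst finite_measure_Diff, auto)
  qed
  moreover have "0 \<le> cdf \<sigma> c - joint_cdf \<gamma> d c" "0 \<le> cdf \<rho> c - joint_cdf \<gamma> c d" for c d
    using joint_cdf_le[of c d] joint_cdf_le[of d c] by auto
  ultimately show ?thesis
    by (simp add: transport_defect_def emeasure_eq_measure del: min.bounded_iff max_less_iff_conj)
qed

lemma joint_cdf_right_continuous:
  assumes "joint_cdf \<gamma> a b < c"
  obtains e where "e > 0" "joint_cdf \<gamma> (a + e) (b + e) < c"
proof -
  let ?A = "\<lambda>n. {..a + 1 / Suc n} \<times> {..b + 1 / Suc n}"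
  have le: "1 / real (Suc n) \<le> 1 / real (Suc k)" if "k \<le> n" for k n
    using that by (simp add: frac_le)
  have "(\<lambda>n. measure \<gamma> (?A n)) \<longlonglongrightarrow> measure \<gamma> (\<Inter>n. ?A n)"
    using le by (intro finite_Lim_measure_decseq) (auto simp: decseq_def intro: order_trans add_left_mono)
  also have "(\<Inter>n. ?A n) = {..a} \<times> {..b}"
  proof -
    have *: "x \<le> y" if "\<And>n. x \<le> y + 1 / Suc n" for x y :: real
    proof (rule field_le_epsilon)
      fix e :: real assume "0 < e"
      then obtain n where "1 / Suc n < e" using nat_approx_posE by blast
      with that[of n] show "x \<le> y + e" by simp
    qed
    show ?thesis by (auto intro: * simp: add_increasing2)
  qed
  finally have "eventually (\<lambda>n. measure \<gamma> (?A n) < c) sequentially"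
    using assms by (intro order_tendstoD) (simp_all add: joint_cdf_def)
  then obtain n where "measure \<gamma> (?A n) < c" by (auto simp: eventually_sequentially)
  then show ?thesis using that[of "1 / Suc n"] by (simp add: joint_cdf_def)
qed

lemma transport_cost_finite:
  assumes "\<sigma> \<in> M2 m"
  shows "transport_cost \<gamma> < \<infinity>"
proof -
  note [measurable_cong] = couplings_D(2)[OF \<gamma>]
  have "transport_cost \<gamma> \<le> (\<integral>\<^sup>+ z. 2 * ennreal ((fst z)\<^sup>2) + 2 * ennreal ((snd z)\<^sup>2) \<partial>\<gamma>)"
    unfolding transport_cost_eq
  proof (rule nn_integral_mono)
    fix z :: "real \<times> real"
    have "(x - y)\<^sup>2 \<le> 2 * x\<^sup>2 + 2 * y\<^sup>2" for x y :: real
      using zero_le_power2[of "x + y"] by (simp add: power2_sum power2_diff)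
    then have "ennreal ((fst z - snd z)\<^sup>2) \<le> ennreal (2 * (fst z)\<^sup>2 + 2 * (snd z)\<^sup>2)" by (intro ennreal_leI)
    then show "ennreal ((fst z - snd z)\<^sup>2) \<le> 2 * ennreal ((fst z)\<^sup>2) + 2 * ennreal ((snd z)\<^sup>2)"
      by (simp add: ennreal_mult)
  qed
  also have "\<dots> = 2 * (\<integral>\<^sup>+ x. ennreal (x\<^sup>2) \<partial>\<rho>) + 2 * (\<integral>\<^sup>+ x. ennreal (x\<^sup>2) \<partial>\<sigma>)"
    by (simp add: nn_integral_add nn_integral_cmult nn_integral_coupling[OF \<gamma>])
  also have "\<dots> < \<infinity>" using M2_D(4)[OF \<rho>] M2_D(4)[OF assms] by (simp add: ennreal_mult_less_top)
  finally show ?thesis .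
qed

end

context
  fixes m :: real and \<rho> \<sigma> :: "real measure"
  assumes \<rho>: "\<rho> \<in> M2 m" and \<sigma>: "\<sigma> \<in> M2 m" and m: "0 < m"
begin

private abbreviation "\<gamma>q \<equiv> quantile_coupling m \<rho> \<sigma>"

private lemma \<gamma>q: "\<gamma>q \<in> couplings \<rho> \<sigma>"
  by (rule quantile_coupling_in_couplings[OF \<rho> \<sigma> m])

private lemma joint_cdf_\<gamma>q: "joint_cdf \<gamma>q a b = min (cdf \<rho> a) (cdf \<sigma> b)"
  by (simp add: joint_cdf_def measure_def quantile_coupling_quadrant[OF \<rho> \<sigma> m])
     (simp add: cdf_def)

private lemma defect_mono: "\<gamma> \<in> couplings \<rho> \<sigma> \<Longrightarrow> transport_defect \<gamma>q p \<le> transport_defect \<gamma> p"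
  unfolding transport_defect_eq[OF \<rho> \<gamma>q] transport_defect_eq[OF \<rho>, of \<gamma> \<sigma>] joint_cdf_\<gamma>q
  using joint_cdf_le[OF \<rho>, of \<gamma> \<sigma>] by (intro ennreal_leI add_mono diff_left_mono) auto

lemma quantile_coupling_optimal:
  assumes \<gamma>: "\<gamma> \<in> couplings \<rho> \<sigma>"
  shows "transport_cost \<gamma>q \<le> transport_cost \<gamma>"
  using defect_mono[OF \<gamma>]
  by (simp add: transport_cost_defect(1) couplings_D[OF \<gamma>] couplings_D[OF \<gamma>q]
      finite_measure_coupling[OF \<rho> \<gamma>] finite_measure_coupling[OF \<rho> \<gamma>q] nn_integral_mono)

text \<open>
  Equal costs force equal defects almost everywhere. If the joint distribution function were below its
  upper bound \<open>min (cdf \<rho> a) (cdf \<sigma> b)\<close> at one point, then by right continuity it would stay below on a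
  square of positive area.
\<close>

lemma optimal_coupling_unique:
  assumes \<gamma>: "\<gamma> \<in> couplings \<rho> \<sigma>" and le: "transport_cost \<gamma> \<le> transport_cost \<gamma>q"
  shows "\<gamma> = \<gamma>q"
proof -
  note f = finite_measure_coupling[OF \<rho> \<gamma>] finite_measure_coupling[OF \<rho> \<gamma>q]
  note cd = transport_cost_defect[OF couplings_D(1)[OF \<gamma>] f(1)] transport_cost_defect[OF couplings_D(1)[OF \<gamma>q] f(2)]
  have ae: "AE p in lborel \<Otimes>\<^sub>M lborel. transport_defect \<gamma> p \<le> transport_defect \<gamma>q p"
  proof (rule ccontr)
    assume "\<not> ?thesis"
    then have "transport_cost \<gamma>q < transport_cost \<gamma>"
      unfolding cd using cd transport_cost_finite[OF \<rho> \<gamma>q \<sigma>] defect_mono[OF \<gamma>]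
      by (intro nn_integral_less) auto
    with le show False by simp
  qed
  have ge: "min (cdf \<rho> a) (cdf \<sigma> b) \<le> joint_cdf \<gamma> a b" for a b
  proof (rule ccontr)
    assume "\<not> ?thesis"
    then obtain e where e: "e > 0" "joint_cdf \<gamma> (a + e) (b + e) < min (cdf \<rho> a) (cdf \<sigma> b)"
      using joint_cdf_right_continuous[OF \<rho> \<gamma>, of a b "min (cdf \<rho> a) (cdf \<sigma> b)"] by (auto simp: not_le)
    let ?S = "{a..a + e} \<times> {b..b + e}"
    have "AE p in lborel \<Otimes>\<^sub>M lborel. p \<notin> ?S"
      using ae
    proof eventually_elim
      case (elim p)
      show ?case
      proof
        assume p: "p \<in> ?S"
        have "joint_cdf \<gamma> (fst p) (snd p) \<le> joint_cdf \<gamma> (a + e) (b + e)"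
          using p by (intro joint_cdf_mono[OF \<rho> \<gamma>]) auto
        also note e(2)
        also have "min (cdf \<rho> a) (cdf \<sigma> b) \<le> min (cdf \<rho> (fst p)) (cdf \<sigma> (snd p))"
          using p finite_borel_measure.cdf_nondecreasing[OF M2_finite_borel_measure[OF \<rho>], of a "fst p"]
            finite_borel_measure.cdf_nondecreasing[OF M2_finite_borel_measure[OF \<sigma>], of b "snd p"]
          by (intro min.mono) auto
        finally have lt: "joint_cdf \<gamma> (fst p) (snd p) < joint_cdf \<gamma>q (fst p) (snd p)"
          by (simp add: joint_cdf_\<gamma>q)
        have H: "joint_cdf \<gamma> x y \<le> joint_cdf \<gamma>q x y" for x y
          using joint_cdf_le[OF \<rho> \<gamma>] by (simp add: joint_cdf_\<gamma>q)
        have nn: "joint_cdf \<gamma>q x y \<le> cdf \<sigma> y" "joint_cdf \<gamma>q x y \<le> cdf \<rho> x" for x y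
          by (auto simp: joint_cdf_\<gamma>q)
        \<comment> \<open>Whether \<open>p\<close> lies above or below the diagonal, the joint distribution function at \<open>p\<close> is one of the two terms in the defect at \<open>p\<close>.\<close>
        let ?c = "min (fst p) (snd p)" and ?d = "max (fst p) (snd p)"
        have "cdf \<sigma> ?c - joint_cdf \<gamma> ?d ?c + (cdf \<rho> ?c - joint_cdf \<gamma> ?c ?d)
            \<le> cdf \<sigma> ?c - joint_cdf \<gamma>q ?d ?c + (cdf \<rho> ?c - joint_cdf \<gamma>q ?c ?d)"
          using elim nn[of ?d ?c] nn[of ?c ?d] unfolding transport_defect_eq[OF \<rho> \<gamma>] transport_defect_eq[OF \<rho> \<gamma>q]
          by (subst (asm) ennreal_le_iff) auto
        with H[of ?d ?c] H[of ?c ?d] have "joint_cdf \<gamma> ?d ?c = joint_cdf \<gamma>q ?d ?c" "joint_cdf \<gamma> ?c ?d = joint_cdf \<gamma>q ?c ?d"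
          by linarith+
        with lt show False by (cases "fst p \<le> snd p") (auto simp: min_def max_def)
      qed
    qed
    then have "emeasure (lborel \<Otimes>\<^sub>M lborel) ?S = 0"
      by (subst (asm) AE_iff_measurable[OF _ refl]) (auto simp: space_pair_measure)
    moreover have "emeasure (lborel \<Otimes>\<^sub>M lborel) ?S = ennreal (e * e)"
      using e by (simp add: lborel.emeasure_pair_measure_Times ennreal_mult)
    ultimately show False using e by simp
  qed
  have "joint_cdf \<gamma> a b = joint_cdf \<gamma>q a b" for a b
    using ge[of a b] joint_cdf_le[OF \<rho> \<gamma>, of a b] by (simp add: joint_cdf_\<gamma>q)
  then show ?thesis
    using f by (intro measure_eqI_quadrants)
      (auto simp: couplings_D[OF \<gamma>] couplings_D[OF \<gamma>q] joint_cdf_def finite_measure.emeasure_eq_measure)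
qed

lemma optimal_coupling_eq: "optimal_coupling \<rho> \<sigma> = \<gamma>q"
  unfolding optimal_coupling_def
  by (rule the_equality) (use \<gamma>q quantile_coupling_optimal optimal_coupling_unique in blast)+

lemma W2_eq: "W2 \<rho> \<sigma> = sqrt (enn2real (transport_cost \<gamma>q))"
proof -
  have "(INF \<gamma>\<in>couplings \<rho> \<sigma>. transport_cost \<gamma>) = transport_cost \<gamma>q"
    using \<gamma>q quantile_coupling_optimal by (intro antisym INF_lower INF_greatest) auto
  then show ?thesis by (simp add: W2_def)
qed

lemma transport_cost_quantile: "transport_cost \<gamma>q = ennreal ((W2 \<rho> \<sigma>)\<^sup>2)"
  using transport_cost_finite[OF \<rho> \<gamma>q \<sigma>] by (simp add: W2_eq)

lemma transport_cost_less:
  assumes "W2 \<rho> \<sigma> < \<delta>"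
  shows "transport_cost \<gamma>q < ennreal (\<delta>\<^sup>2)"
proof -
  have "0 \<le> W2 \<rho> \<sigma>" by (simp add: W2_eq)
  with assms show ?thesis unfolding transport_cost_quantile by (intro ennreal_lessI) (auto intro: power_strict_mono)
qed

lemma displacement_interpolation_eq:
  "displacement_interpolation \<rho> \<sigma> \<theta> =
     distr (levels m) borel (\<lambda>w. (1 - \<theta>) * quantile \<rho> w + \<theta> * quantile \<sigma> w)"
proof -
  note [measurable] = quantile_measurable[OF \<rho> m] quantile_measurable[OF \<sigma> m]
  show ?thesis
    unfolding displacement_interpolation_def optimal_coupling_eq quantile_coupling_def
    by (subst distr_distr) (auto simp: comp_def borel_prod[symmetric])
qed

end

lemma M2_second_moment:
  assumes "\<rho> \<in> M2 m"
  obtains S where "0 \<le> S" "(\<integral>\<^sup>+ x. ennreal (x\<^sup>2) \<partial>\<rho>) = ennreal S"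
  using M2_D(4)[OF assms] by (cases "\<integral>\<^sup>+ x. ennreal (x\<^sup>2) \<partial>\<rho>") auto

lemma second_moment_W2:
  assumes \<rho>: "\<rho> \<in> M2 m" and \<sigma>: "\<sigma> \<in> M2 m" and m: "0 < m" and W: "W2 \<rho> \<sigma> < \<delta>" and \<delta>: "\<delta> \<le> 1"
    and S: "(\<integral>\<^sup>+ x. ennreal (x\<^sup>2) \<partial>\<rho>) \<le> ennreal S" "0 \<le> S"
  shows "(\<integral>\<^sup>+ x. ennreal (x\<^sup>2) \<partial>\<sigma>) \<le> ennreal (S + \<delta> * (S + 2))"
proof -
  have "0 \<le> W2 \<rho> \<sigma>" by (simp add: W2_eq[OF \<rho> \<sigma> m])
  then show ?thesis
    using second_moment_usc[OF quantile_coupling_in_couplings[OF \<rho> \<sigma> m] _ _ \<delta> S] W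
      transport_cost_less[OF \<rho> \<sigma> m W] by simp
qed

section \<open>The internal energy\<close>

text \<open>
  A Lebesgue null set \<open>N\<close> of the largest possible \<open>\<rho>\<close>-mass carries the singular part: outside \<open>N\<close> every
  Lebesgue null set has \<open>\<rho>\<close>-mass zero, so that the Radon-Nikodym theorem applies there.
\<close>

lemma lebesgue_decomposition_exists:
  assumes fin: "finite_measure \<rho>" and sets: "sets \<rho> = sets borel"
  shows "\<exists>u \<rho>s. lebesgue_decomposition \<rho> u \<rho>s"
proof -
  interpret finite_measure \<rho> by (rule fin)
  note [measurable_cong] = sets
  let ?N = "null_sets lborel :: real set set"
  have "{} \<in> ?N" by auto
  then have "?N \<noteq> {}" by blast
  then obtain f :: "nat \<Rightarrow> ennreal" where f: "range f \<subseteq> emeasure \<rho> ` ?N" "(SUP N\<in>?N. emeasure \<rho> N) = (SUP i. f i)"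
    using ennreal_SUP_countable_SUP[of ?N "emeasure \<rho>"] by auto
  then have "\<forall>i. \<exists>N\<in>?N. f i = emeasure \<rho> N" by auto
  then obtain Ni where Ni: "\<And>i. Ni i \<in> ?N" "\<And>i. f i = emeasure \<rho> (Ni i)" by metis
  define N where "N = (\<Union>i. Ni i)"
  have N: "N \<in> ?N" unfolding N_def using Ni by blast
  then have [measurable]: "N \<in> sets borel" and N0: "emeasure lborel N = 0" by (auto simp: null_sets_def)
  have max: "emeasure \<rho> A \<le> emeasure \<rho> N" if "A \<in> ?N" for A
  proof -
    have "emeasure \<rho> A \<le> (SUP i. f i)" using that unfolding f(2)[symmetric] by (rule SUP_upper)
    also have "\<dots> \<le> emeasure \<rho> N"
    proof (rule SUP_least)
      fix i
      have "Ni i \<subseteq> N" unfolding N_def by blast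
      then show "f i \<le> emeasure \<rho> N" by (simp add: Ni(2) emeasure_mono sets)
    qed
    finally show ?thesis .
  qed
  define \<rho>a where "\<rho>a = density \<rho> (indicator (- N))"
  have em_a: "emeasure \<rho>a A = emeasure \<rho> (A - N)" if [measurable]: "A \<in> sets borel" for A
    unfolding \<rho>a_def by (simp add: emeasure_density sets Diff_eq Int_commute flip: indicator_inter_arith)
  have "absolutely_continuous lborel \<rho>a"
    unfolding absolutely_continuous_def
  proof
    fix A assume A: "A \<in> ?N"
    then have [measurable]: "A \<in> sets borel" by auto
    have "emeasure \<rho> (A - N) + emeasure \<rho> N = emeasure \<rho> (A \<union> N)"
      using sets by (subst plus_emeasure) (auto intro: arg_cong[where f="emeasure \<rho>"])
    also have "\<dots> \<le> emeasure \<rho> N" using A N by (intro max) auto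
    finally have "emeasure \<rho> (A - N) = 0"
      by (simp add: emeasure_eq_measure measure_nonneg flip: ennreal_plus)
         (metis add_le_same_cancel2 antisym measure_nonneg)
    then show "A \<in> null_sets \<rho>a" using em_a[of A] by (auto simp: null_sets_def \<rho>a_def sets)
  qed
  then obtain g where g [measurable]: "g \<in> borel_measurable lborel" and dens: "density lborel g = \<rho>a"
    using sigma_finite_measure.Radon_Nikodym[OF sigma_finite_lborel, of \<rho>a] by (auto simp: \<rho>a_def sets)
  have em_g: "(\<integral>\<^sup>+ x\<in>A. g x \<partial>lborel) = emeasure \<rho> (A - N)" if "A \<in> sets borel" for A
    using that em_a[OF that] unfolding dens[symmetric] by (simp add: emeasure_density)
  have "(\<integral>\<^sup>+ x. g x \<partial>lborel) \<noteq> \<infinity>" using em_g[of UNIV] by (simp add: emeasure_eq_measure)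
  then have ae: "AE x in lborel. ennreal (enn2real (g x)) = g x"
    using nn_integral_PInf_AE[OF g] by (auto simp: less_top)
  define u where "u x = enn2real (g x)" for x
  have u: "(\<integral>\<^sup>+ x\<in>A. ennreal (u x) \<partial>lborel) = emeasure \<rho> (A - N)" if "A \<in> sets borel" for A
    unfolding em_g[OF that, symmetric] using ae by (intro nn_integral_cong_AE) (auto simp: u_def)
  define \<rho>s where "\<rho>s = density \<rho> (indicator N)"
  have em_s: "emeasure \<rho>s A = emeasure \<rho> (A \<inter> N)" if [measurable]: "A \<in> sets borel" for A
    unfolding \<rho>s_def by (simp add: emeasure_density sets Int_commute flip: indicator_inter_arith)
  have "lebesgue_decomposition \<rho> u \<rho>s"
    unfolding lebesgue_decomposition_def
  proof (intro conjI allI ballI)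
    show "u \<in> borel_measurable borel" unfolding u_def by measurable
    show "0 \<le> u x" for x by (simp add: u_def)
    show "sets \<rho>s = sets borel" by (simp add: \<rho>s_def sets)
    show "\<exists>N\<in>sets borel. emeasure lborel N = 0 \<and> emeasure \<rho>s (- N) = 0"
      using N0 by (intro bexI[of _ N]) (auto simp: em_s)
    fix A :: "real set" assume A: "A \<in> sets borel"
    have "emeasure \<rho> A = emeasure \<rho> (A - N) + emeasure \<rho> (A \<inter> N)"
      using A sets by (subst plus_emeasure) (auto intro: arg_cong[where f="emeasure \<rho>"])
    then show "emeasure \<rho> A = (\<integral>\<^sup>+ x\<in>A. ennreal (u x) \<partial>lborel) + emeasure \<rho>s A"
      by (simp add: u[OF A] em_s[OF A])
  qed
  then show ?thesis by blast
qed

lemma ac_density_decomposition: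
  assumes "\<rho> \<in> M2 m"
  obtains \<rho>s where "lebesgue_decomposition \<rho> (ac_density \<rho>) \<rho>s"
  using someI_ex[OF lebesgue_decomposition_exists[OF M2_D(3,1)[OF assms]]] unfolding ac_density_def by blast

text \<open>
  For \<open>s \<le> 1\<close> the competitor \<open>- {-R..R}\<close> with \<open>R = 1 / sqrt s\<close> balances the Chebyshev bound
  \<open>S / R\<^sup>2\<close> against \<open>2 * R * s\<close>; for \<open>s > 1\<close> the total mass is a sufficient bound.
\<close>

lemma capped_mass_le_sqrt:
  assumes \<rho>: "\<rho> \<in> M2 m" and m: "0 \<le> m" and S: "(\<integral>\<^sup>+ x. ennreal (x\<^sup>2) \<partial>\<rho>) \<le> ennreal S" "0 \<le> S" and s: "0 < s"
  shows "capped_mass s \<rho> \<le> ennreal ((m + S + 2) * sqrt s)"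
proof (cases "s \<le> 1")
  case False
  then have "1 \<le> sqrt s" by simp
  then have "(m + S + 2) * 1 \<le> (m + S + 2) * sqrt s" using m S by (intro mult_left_mono) auto
  then have "m \<le> (m + S + 2) * sqrt s" using S by simp
  then show ?thesis
    using capped_mass_le_mass[OF M2_D(1)[OF \<rho>], of s] M2_D(2)[OF \<rho>] by (metis ennreal_leI order_trans)
next
  case True
  note [measurable_cong] = M2_D(1)[OF \<rho>]
  define R where "R = 1 / sqrt s"
  have R: "0 < R" "s * R = sqrt s" "s * R\<^sup>2 = 1"
    using s by (auto simp: R_def real_div_sqrt power2_eq_square)
  have "capped_mass s \<rho> \<le> emeasure \<rho> (- {-R..R}) + ennreal s * emeasure lborel {-R..R}"
    unfolding capped_mass_def by (rule INF_lower2[of "- {-R..R}"]) auto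
  also have "emeasure lborel {-R..R} = ennreal (2 * R)" using R by simp
  also have "ennreal s * ennreal (2 * R) = ennreal (2 * sqrt s)"
    using s R by (simp flip: ennreal_mult)
  also have "emeasure \<rho> (- {-R..R}) = (\<integral>\<^sup>+ x. indicator (- {-R..R}) x \<partial>\<rho>)"
    using M2_D(1)[OF \<rho>] by (intro nn_integral_indicator[symmetric]) auto
  also have "\<dots> \<le> (\<integral>\<^sup>+ x. ennreal s * ennreal (x\<^sup>2) \<partial>\<rho>)"
  proof (rule nn_integral_mono)
    fix x :: real
    show "indicator (- {-R..R}) x \<le> ennreal s * ennreal (x\<^sup>2)"
    proof (cases "x \<in> {-R..R}")
      case False
      then have "R\<^sup>2 \<le> x\<^sup>2" using R by (subst abs_le_square_iff[symmetric]) auto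
      then have "s * R\<^sup>2 \<le> s * x\<^sup>2" using s by (intro mult_left_mono) auto
      then show ?thesis using s R False by (simp add: ennreal_1[symmetric] ennreal_leI del: ennreal_1 flip: ennreal_mult)
    qed simp
  qed
  also have "\<dots> = ennreal s * (\<integral>\<^sup>+ x. ennreal (x\<^sup>2) \<partial>\<rho>)" by (rule nn_integral_cmult) simp
  also have "\<dots> \<le> ennreal s * ennreal S" using S by (intro mult_left_mono) auto
  also have "ennreal s * ennreal S + ennreal (2 * sqrt s) = ennreal (s * S + 2 * sqrt s)"
    using s S by (simp flip: ennreal_mult ennreal_plus)
  also have "\<dots> \<le> ennreal ((m + S + 2) * sqrt s)"
  proof (rule ennreal_leI)
    have "s * S \<le> sqrt s * S"
      using s True S by (intro mult_right_mono real_le_rsqrt) (auto simp: power2_eq_square mult_left_le)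
    moreover have "0 \<le> m * sqrt s" using m s by simp
    ultimately show "s * S + 2 * sqrt s \<le> (m + S + 2) * sqrt s" by (simp add: algebra_simps)
  qed
  finally show ?thesis by (simp add: add_mono)
qed

text \<open>
  The weight of the layer at height \<open>s\<close>: the second derivative of the energy density, because
  \<open>(E_fun \<beta>)'' s = deriv \<beta> s / s\<close>.
\<close>

definition level_weight :: "(real \<Rightarrow> real) \<Rightarrow> real \<Rightarrow> ennreal" where
  "level_weight \<beta> s = ennreal (deriv \<beta> s / s) * indicator {0<..} s"

text \<open>
  The negative of \<open>(\<integral> x. E_fun \<beta> (u x))\<close>, see \<open>ext_integral_E_fun\<close>; the sign makes it an
  integral of nonnegative functions.
\<close>

definition internal_energy :: "(real \<Rightarrow> real) \<Rightarrow> real measure \<Rightarrow> ennreal" where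
  "internal_energy \<beta> \<rho> = (\<integral>\<^sup>+ s. level_weight \<beta> s * capped_mass s \<rho> \<partial>lborel)"

context
  fixes \<beta> :: "real \<Rightarrow> real" and \<beta>_inf :: real
  assumes C1: "C1_on {0..} \<beta>" and mono: "strict_mono_on {0..} \<beta>" and \<beta>0: "\<beta> 0 = 0"
    and lim: "(\<beta> \<longlongrightarrow> \<beta>_inf) at_top"
begin

text \<open>
  At \<open>0\<close> the derivative is one-sided and \<open>deriv \<beta> 0\<close> carries no information, hence a separate name \<open>b\<close> for
  the continuous derivative.
\<close>

lemma derivative_facts:
  obtains b where "\<And>x. 0 \<le> x \<Longrightarrow> (\<beta> has_real_derivative b x) (at x within {0..})" "continuous_on {0..} b"
    "\<And>x. 0 < x \<Longrightarrow> (\<beta> has_real_derivative b x) (at x)" "\<And>x. 0 < x \<Longrightarrow> deriv \<beta> x = b x" "\<And>x. 0 \<le> x \<Longrightarrow> 0 \<le> b x"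
proof -
  from C1 obtain b where b: "\<And>x. 0 \<le> x \<Longrightarrow> (\<beta> has_real_derivative b x) (at x within {0..})" "continuous_on {0..} b"
    by (auto simp: C1_on_def)
  have at: "at x within {0..} = at x" if "0 < x" for x :: real
    using that by (intro at_within_open_subset[of x "{0<..}"]) auto
  have d: "(\<beta> has_real_derivative b x) (at x)" if "0 < x" for x
    using b(1)[of x] that unfolding at[OF that] by simp
  have nn: "0 \<le> b x" if x: "0 \<le> x" for x
  proof (rule tendsto_lowerbound)
    show "((\<lambda>y. (\<beta> y - \<beta> x) / (y - x)) \<longlongrightarrow> b x) (at x within {0..})"
      using b(1)[OF x] by (simp add: has_field_derivative_iff)
    have "0 \<le> (\<beta> y - \<beta> x) / (y - x)" if "0 \<le> y" for y
      using strict_mono_on_leD[OF mono, of x y] strict_mono_on_leD[OF mono, of y x] x that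
      by (cases "x \<le> y") (auto simp: divide_nonpos_nonpos)
    then show "\<forall>\<^sub>F y in at x within {0..}. 0 \<le> (\<beta> y - \<beta> x) / (y - x)"
      by (auto simp: eventually_at_filter)
    show "at x within {0..} \<noteq> bot"
    proof (cases "x = 0")
      case True
      then show ?thesis by (simp add: at_within_Ici_at_right)
    next
      case False
      then show ?thesis using x at[of x] by simp
    qed
  qed
  show ?thesis
    by (rule that[of b]) (use b d nn in \<open>auto intro: DERIV_imp_deriv\<close>)
qed

lemma deriv_measurable [measurable]: "(\<lambda>s. indicator {0<..} s * deriv \<beta> s) \<in> borel_measurable borel"
proof -
  obtain b where b: "continuous_on {0..} b" "\<And>x. 0 < x \<Longrightarrow> deriv \<beta> x = b x" by (rule derivative_facts) blast
  have "continuous_on {0<..} b" using b(1) by (rule continuous_on_subset) auto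
  then have "(\<lambda>s. indicator {0<..} s *\<^sub>R b s) \<in> borel_measurable borel"
    by (intro borel_measurable_continuous_on_indicator) auto
  also have "(\<lambda>s. indicator {0<..} s *\<^sub>R b s) = (\<lambda>s. indicator {0<..} s * deriv \<beta> s)"
    using b(2) by (auto simp: indicator_def)
  finally show ?thesis .
qed

lemma level_weight_alt: "level_weight \<beta> s = ennreal (indicator {0<..} s * deriv \<beta> s / s)"
  by (simp add: level_weight_def indicator_def)

lemma level_weight_measurable [measurable]: "level_weight \<beta> \<in> borel_measurable borel"
  unfolding level_weight_alt[abs_def] by measurable

lemma \<beta>_nonneg: "0 \<le> r \<Longrightarrow> 0 \<le> \<beta> r"
  using strict_mono_on_leD[OF mono, of 0 r] \<beta>0 by simp

lemma nn_integral_deriv_initial: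
  assumes r: "0 \<le> r"
  shows "(\<integral>\<^sup>+ s. ennreal (deriv \<beta> s) * indicator {0<..<r} s \<partial>lborel) = ennreal (\<beta> r)"
proof -
  obtain b where b: "\<And>x. 0 \<le> x \<Longrightarrow> (\<beta> has_real_derivative b x) (at x within {0..})" "continuous_on {0..} b"
    "\<And>x. 0 < x \<Longrightarrow> deriv \<beta> x = b x" "\<And>x. 0 \<le> x \<Longrightarrow> 0 \<le> b x"
    by (rule derivative_facts) blast
  have "has_bochner_integral lborel (\<lambda>x. indicator {0..r} x *\<^sub>R b x) (\<beta> r - \<beta> 0)"
    using b(1,2) r
    by (intro has_bochner_integral_FTC_Icc)
       (auto simp: has_real_derivative_iff_has_vector_derivative[symmetric]
         intro: has_field_derivative_subset[where s="{0..}"] continuous_on_subset[where s="{0..}"])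
  then have int: "integrable lborel (\<lambda>x. indicator {0..r} x *\<^sub>R b x)" "(\<integral>x. indicator {0..r} x *\<^sub>R b x \<partial>lborel) = \<beta> r"
    using \<beta>0 by (auto simp: has_bochner_integral_iff)
  have "(\<integral>\<^sup>+ s. ennreal (deriv \<beta> s) * indicator {0<..<r} s \<partial>lborel) = (\<integral>\<^sup>+ s. ennreal (indicator {0..r} s *\<^sub>R b s) \<partial>lborel)"
    using AE_lborel_singleton[of 0] AE_lborel_singleton[of r]
    by (intro nn_integral_cong_AE, eventually_elim) (auto simp: indicator_def b(3))
  also have "\<dots> = ennreal (\<beta> r)"
    using b(4) int by (subst nn_integral_eq_integral) (auto simp: indicator_def)
  finally show ?thesis .
qed

lemma nn_integral_deriv_tail:
  assumes r: "0 < r"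
  shows "(\<integral>\<^sup>+ s. ennreal (deriv \<beta> s) * indicator {r..} s \<partial>lborel) = ennreal (\<beta>_inf - \<beta> r)"
proof -
  obtain b where b: "\<And>x. 0 < x \<Longrightarrow> (\<beta> has_real_derivative b x) (at x)"
    "\<And>x. 0 < x \<Longrightarrow> deriv \<beta> x = b x" "\<And>x. 0 \<le> x \<Longrightarrow> 0 \<le> b x"
    by (rule derivative_facts) blast
  have "(\<integral>\<^sup>+ s. ennreal (deriv \<beta> s) * indicator {r..} s \<partial>lborel)
      = (\<integral>\<^sup>+ s. ennreal (indicator {0<..} s * deriv \<beta> s) * indicator {r..} s \<partial>lborel)"
    using r by (intro nn_integral_cong) (auto simp: indicator_def)
  also have "\<dots> = ennreal (\<beta>_inf - \<beta> r)"
    using b r by (intro nn_integral_FTC_atLeast lim) auto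
  finally show ?thesis .
qed

text \<open>
  The layer formula for the energy density: split the integral at \<open>s = r\<close>, and use the fundamental
  theorem of calculus below and above.
\<close>

lemma E_fun_level_weight:
  assumes r: "0 \<le> r"
  shows "E_fun \<beta> r \<le> 0" "ennreal (- E_fun \<beta> r) = (\<integral>\<^sup>+ s. level_weight \<beta> s * ennreal (min r s) \<partial>lborel)"
proof -
  have "E_fun \<beta> r \<le> 0 \<and> ennreal (- E_fun \<beta> r) = (\<integral>\<^sup>+ s. level_weight \<beta> s * ennreal (min r s) \<partial>lborel)"
  proof (cases "r = 0")
    case True
    have "(\<integral>\<^sup>+ s. level_weight \<beta> s * ennreal (min r s) \<partial>lborel) = (\<integral>\<^sup>+ s. 0 \<partial>(lborel :: real measure))"
      using True by (intro nn_integral_cong) (auto simp: level_weight_def indicator_def min_def)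
    then show ?thesis using True by (simp add: E_fun_def)
  next
    case False
    with r have r: "0 < r" by simp
    obtain b where b: "\<And>x. 0 < x \<Longrightarrow> deriv \<beta> x = b x" "\<And>x. 0 \<le> x \<Longrightarrow> 0 \<le> b x"
      by (rule derivative_facts) blast
    have dnn: "0 \<le> deriv \<beta> s" if "0 < s" for s using b that by simp
    let ?J = "\<integral>\<^sup>+ s. ennreal (deriv \<beta> s / s) * indicator {r..} s \<partial>lborel"
    let ?L = "LBINT s:{r..}. deriv \<beta> s / s"
    have J_meas: "(\<lambda>s. indicator {r..} s *\<^sub>R (deriv \<beta> s / s)) \<in> borel_measurable lborel"
    proof -
      have "(\<lambda>s. indicator {r..} s *\<^sub>R (deriv \<beta> s / s)) = (\<lambda>s. indicator {r..} s * (indicator {0<..} s * deriv \<beta> s) / s)"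
        using r by (auto simp: indicator_def)
      then show ?thesis by simp
    qed
    have J_eq: "?J = (\<integral>\<^sup>+ s. ennreal (indicator {r..} s *\<^sub>R (deriv \<beta> s / s)) \<partial>lborel)"
      by (intro nn_integral_cong) (auto simp: indicator_def)
    have "?J \<le> (\<integral>\<^sup>+ s. ennreal (1/r) * (ennreal (deriv \<beta> s) * indicator {r..} s) \<partial>lborel)"
    proof (rule nn_integral_mono)
      fix s
      have "deriv \<beta> s / s \<le> 1 / r * deriv \<beta> s" if "r \<le> s"
        using that r dnn[of s] by (simp add: divide_left_mono)
      then show "ennreal (deriv \<beta> s / s) * indicator {r..} s \<le> ennreal (1/r) * (ennreal (deriv \<beta> s) * indicator {r..} s)"
        using r dnn[of s] by (auto simp: indicator_def simp flip: ennreal_mult intro!: ennreal_leI)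
    qed
    also have "\<dots> = ennreal (1/r) * (\<integral>\<^sup>+ s. ennreal (deriv \<beta> s) * indicator {r..} s \<partial>lborel)"
    proof (rule nn_integral_cmult)
      have "(\<lambda>s. ennreal (deriv \<beta> s) * indicator {r..} s) = (\<lambda>s. ennreal (indicator {0<..} s * deriv \<beta> s) * indicator {r..} s)"
        using r by (auto simp: indicator_def)
      then show "(\<lambda>s. ennreal (deriv \<beta> s) * indicator {r..} s) \<in> borel_measurable lborel" by simp
    qed
    also have "\<dots> < \<infinity>" unfolding nn_integral_deriv_tail[OF r] by (simp add: ennreal_mult_less_top)
    finally have Jfin: "?J < \<infinity>" .
    have nonneg: "0 \<le> indicator {r..} s *\<^sub>R (deriv \<beta> s / s)" for s
      using r dnn[of s] by (simp add: indicator_def)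
    have "?L = enn2real ?J"
      unfolding set_lebesgue_integral_def J_eq using J_meas nonneg by (intro integral_eq_nn_integral) auto
    then have L: "ennreal ?L = ?J" "0 \<le> ?L" using Jfin by auto
    have E: "- E_fun \<beta> r = \<beta> r + r * ?L" using r by (simp add: E_fun_def)
    have "(\<integral>\<^sup>+ s. level_weight \<beta> s * ennreal (min r s) \<partial>lborel)
        = (\<integral>\<^sup>+ s. ennreal (deriv \<beta> s) * indicator {0<..<r} s + ennreal r * (ennreal (deriv \<beta> s / s) * indicator {r..} s) \<partial>lborel)"
      using r dnn
      by (intro nn_integral_cong) (auto simp: level_weight_def indicator_def min_def mult.commute simp flip: ennreal_mult)
    also have "\<dots> = ennreal (\<beta> r) + ennreal r * ?J"
    proof -
      have "(\<lambda>s. ennreal (deriv \<beta> s) * indicator {0<..<r} s) = (\<lambda>s. ennreal (indicator {0<..} s * deriv \<beta> s) * indicator {0<..<r} s)"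
        by (auto simp: indicator_def)
      then have [measurable]: "(\<lambda>s. ennreal (deriv \<beta> s) * indicator {0<..<r} s) \<in> borel_measurable lborel" by simp
      have "(\<lambda>s. ennreal (deriv \<beta> s / s) * indicator {r..} s) = (\<lambda>s. ennreal (indicator {r..} s *\<^sub>R (deriv \<beta> s / s)))"
        by (auto simp: indicator_def)
      then have [measurable]: "(\<lambda>s. ennreal (deriv \<beta> s / s) * indicator {r..} s) \<in> borel_measurable lborel"
        using J_meas by simp
      show ?thesis
        using nn_integral_deriv_initial[of r] r by (subst nn_integral_add) (simp_all add: nn_integral_cmult)
    qed
    also have "\<dots> = ennreal (- E_fun \<beta> r)"
      unfolding E L(1)[symmetric] using L(2) r \<beta>_nonneg[of r] by (simp flip: ennreal_mult ennreal_plus)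
    finally have "ennreal (- E_fun \<beta> r) = (\<integral>\<^sup>+ s. level_weight \<beta> s * ennreal (min r s) \<partial>lborel)" ..
    moreover have "E_fun \<beta> r \<le> 0"
      using E L(2) r \<beta>_nonneg[of r] mult_nonneg_nonneg[of r ?L] by linarith
    ultimately show ?thesis by blast
  qed
  then show "E_fun \<beta> r \<le> 0" "ennreal (- E_fun \<beta> r) = (\<integral>\<^sup>+ s. level_weight \<beta> s * ennreal (min r s) \<partial>lborel)" by auto
qed

text \<open>
  Near \<open>0\<close> the derivative of \<open>\<beta>\<close> is bounded and \<open>1 / sqrt s\<close> is integrable; beyond \<open>1\<close> the
  integrand is at most \<open>deriv \<beta> s\<close>, whose integral is finite because \<open>\<beta>\<close> is bounded.
\<close>

lemma level_weight_sqrt_finite: "(\<integral>\<^sup>+ s. level_weight \<beta> s * ennreal (sqrt s) \<partial>lborel) < \<infinity>"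
proof -
  obtain b where b: "continuous_on {0..} b" "\<And>x. 0 < x \<Longrightarrow> deriv \<beta> x = b x" "\<And>x. 0 \<le> x \<Longrightarrow> 0 \<le> b x"
    by (rule derivative_facts) blast
  have "continuous_on {0..1} b" using b(1) by (rule continuous_on_subset) auto
  then have "bdd_above (b ` {0..1})"
    by (intro bounded_imp_bdd_above compact_imp_bounded compact_continuous_image compact_Icc)
  then obtain K where "\<forall>y\<in>b ` {0..1}. y \<le> K" unfolding bdd_above_def by blast
  then have K: "b s \<le> K" if "s \<in> {0..1}" for s using that by blast
  have K0: "0 \<le> K" using K[of 0] b(3)[of 0] by simp
  have "(\<integral>\<^sup>+ s. level_weight \<beta> s * ennreal (sqrt s) \<partial>lborel)
      \<le> (\<integral>\<^sup>+ s. ennreal K * ennreal (indicator {0..1} s * s powr (-1/2)) + ennreal (deriv \<beta> s) * indicator {1..} s \<partial>lborel)"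
  proof (rule nn_integral_mono)
    fix s :: real
    consider "s \<le> 0" | "0 < s" "s < 1" | "1 \<le> s" by linarith
    then show "level_weight \<beta> s * ennreal (sqrt s)
        \<le> ennreal K * ennreal (indicator {0..1} s * s powr (-1/2)) + ennreal (deriv \<beta> s) * indicator {1..} s"
    proof cases
      case 1
      then show ?thesis by (simp add: level_weight_def)
    next
      case 2
      have "s powr (-1/2) = sqrt s / s"
        using 2 powr_diff[of s "1/2" 1] by (simp add: powr_half_sqrt)
      then have "deriv \<beta> s / s * sqrt s \<le> K * s powr (-1/2)"
        using 2 K[of s] b by (simp add: divide_right_mono mult_right_mono)
      then show ?thesis
        using 2 K0 b by (auto simp: level_weight_def simp flip: ennreal_mult intro!: ennreal_leI)
    next
      case 3
      then have "sqrt s \<le> s" by (intro real_le_lsqrt) (auto simp: power2_eq_square)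
      then have "deriv \<beta> s / s * sqrt s \<le> deriv \<beta> s"
        using 3 b by (simp add: mult_right_mono field_simps)
      then show ?thesis
        using 3 b by (auto simp: level_weight_def simp flip: ennreal_mult intro!: add_increasing ennreal_leI)
    qed
  qed
  also have "\<dots> = ennreal K * (\<integral>\<^sup>+ s. ennreal (indicator {0..1} s * s powr (-1/2)) \<partial>lborel)
     + (\<integral>\<^sup>+ s. ennreal (deriv \<beta> s) * indicator {1..} s \<partial>lborel)"
  proof -
    have "(\<lambda>s. ennreal (deriv \<beta> s) * indicator {1..} s) = (\<lambda>s. ennreal (indicator {0<..} s * deriv \<beta> s) * indicator {1..} s)"
      by (auto simp: indicator_def)
    then show ?thesis by (subst nn_integral_add) (auto simp: nn_integral_cmult)
  qed
  also have "(\<integral>\<^sup>+ s. ennreal (indicator {0..1} s * s powr (-1/2)) \<partial>lborel) = ennreal 2"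
  proof (rule nn_integral_has_integral_lborel)
    have "((\<lambda>s. s powr (-1/2)) has_integral (1 powr (-1/2 + 1) / (-1/2 + 1))) {0..(1::real)}"
      by (rule has_integral_powr_from_0) auto
    then have *: "((\<lambda>s. s powr (-1/2)) has_integral 2) {0..(1::real)}" by simp
    have "(\<lambda>s::real. if s \<in> {0..1} then s powr (-1/2) else 0) = (\<lambda>s. indicator {0..1} s * s powr (-1/2))"
      by (auto simp: indicator_def)
    then show "((\<lambda>s::real. indicator {0..1} s * s powr (-1/2)) has_integral 2) UNIV"
      using * has_integral_restrict_UNIV[of "{0..1::real}" "\<lambda>s. s powr (-1/2)" 2] by simp
  qed auto
  also have "ennreal K * ennreal 2 + (\<integral>\<^sup>+ s. ennreal (deriv \<beta> s) * indicator {1..} s \<partial>lborel) < \<infinity>"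
    unfolding nn_integral_deriv_tail[OF zero_less_one] by (simp add: ennreal_mult_less_top)
  finally show ?thesis .
qed

lemma weighted_capped_mass:
  assumes \<rho>: "\<rho> \<in> M2 m"
  shows "level_weight \<beta> s * capped_mass s \<rho> = level_weight \<beta> s * (\<integral>\<^sup>+ x. ennreal (min (ac_density \<rho> x) s) \<partial>lborel)"
proof (cases "s \<le> 0")
  case False
  obtain \<rho>s where "lebesgue_decomposition \<rho> (ac_density \<rho>) \<rho>s" by (rule ac_density_decomposition[OF \<rho>])
  then show ?thesis using False by (simp add: capped_mass_eq)
qed (simp add: level_weight_def)

lemma ac_density_measurable:
  assumes \<rho>: "\<rho> \<in> M2 m"
  shows "ac_density \<rho> \<in> borel_measurable borel" "0 \<le> ac_density \<rho> x"
proof -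
  obtain \<rho>s where "lebesgue_decomposition \<rho> (ac_density \<rho>) \<rho>s" by (rule ac_density_decomposition[OF \<rho>])
  then show "ac_density \<rho> \<in> borel_measurable borel" "0 \<le> ac_density \<rho> x" by (auto simp: lebesgue_decomposition_def)
qed

lemma weighted_capped_mass_measurable:
  assumes \<rho>: "\<rho> \<in> M2 m"
  shows "(\<lambda>s. level_weight \<beta> s * capped_mass s \<rho>) \<in> borel_measurable lborel"
proof -
  note [measurable] = ac_density_measurable(1)[OF \<rho>]
  have "(\<lambda>s. \<integral>\<^sup>+ x. ennreal (min (ac_density \<rho> x) s) \<partial>lborel) \<in> borel_measurable lborel"
    by (intro lborel.borel_measurable_nn_integral) measurable
  then show ?thesis unfolding weighted_capped_mass[OF \<rho>] by measurable
qed

lemma ext_integral_E_fun: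
  assumes \<rho>: "\<rho> \<in> M2 m"
  shows "ext_integral lborel (\<lambda>x. E_fun \<beta> (ac_density \<rho> x)) = - enn2ereal (internal_energy \<beta> \<rho>)"
proof -
  note [measurable] = ac_density_measurable(1)[OF \<rho>]
  have "(\<integral>\<^sup>+ x. ennreal (E_fun \<beta> (ac_density \<rho> x)) \<partial>lborel) = (\<integral>\<^sup>+ x. 0 \<partial>(lborel :: real measure))"
    using E_fun_level_weight(1) ac_density_measurable(2)[OF \<rho>] by (intro nn_integral_cong) (simp add: ennreal_neg)
  moreover have "(\<integral>\<^sup>+ x. ennreal (- E_fun \<beta> (ac_density \<rho> x)) \<partial>lborel) = internal_energy \<beta> \<rho>"
  proof -
    have "(\<integral>\<^sup>+ x. ennreal (- E_fun \<beta> (ac_density \<rho> x)) \<partial>lborel)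
        = (\<integral>\<^sup>+ x. (\<integral>\<^sup>+ s. level_weight \<beta> s * ennreal (min (ac_density \<rho> x) s) \<partial>lborel) \<partial>lborel)"
      using E_fun_level_weight(2) ac_density_measurable(2)[OF \<rho>] by (intro nn_integral_cong) simp
    also have "\<dots> = (\<integral>\<^sup>+ s. (\<integral>\<^sup>+ x. level_weight \<beta> s * ennreal (min (ac_density \<rho> x) s) \<partial>lborel) \<partial>lborel)"
      by (rule pair_sigma_finite.Fubini'[OF pair_sigma_finite.intro[OF sigma_finite_lborel sigma_finite_lborel]]) measurable
    also have "\<dots> = internal_energy \<beta> \<rho>"
      unfolding internal_energy_def weighted_capped_mass[OF \<rho>]
      by (intro nn_integral_cong nn_integral_cmult) measurable
    finally show ?thesis .
  qed
  ultimately show ?thesis by (simp add: ext_integral_def zero_ennreal.rep_eq)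
qed

lemma weighted_capped_mass_bound:
  assumes \<rho>: "\<rho> \<in> M2 m" and m: "0 \<le> m" and S: "(\<integral>\<^sup>+ x. ennreal (x\<^sup>2) \<partial>\<rho>) \<le> ennreal S" "0 \<le> S"
  shows "level_weight \<beta> s * capped_mass s \<rho> \<le> ennreal (m + S + 2) * (level_weight \<beta> s * ennreal (sqrt s))"
proof (cases "s \<le> 0")
  case False
  then have "capped_mass s \<rho> \<le> ennreal (m + S + 2) * ennreal (sqrt s)"
    using capped_mass_le_sqrt[OF \<rho> m S, of s] m S by (simp add: ennreal_mult)
  then have "level_weight \<beta> s * capped_mass s \<rho> \<le> level_weight \<beta> s * (ennreal (m + S + 2) * ennreal (sqrt s))"
    by (intro mult_left_mono) auto
  then show ?thesis by (simp add: mult.left_commute)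
qed (simp add: level_weight_def)

lemma internal_energy_bound:
  obtains D where "0 \<le> D" "\<And>m \<rho> S. \<rho> \<in> M2 m \<Longrightarrow> 0 \<le> m \<Longrightarrow> (\<integral>\<^sup>+ x. ennreal (x\<^sup>2) \<partial>\<rho>) \<le> ennreal S \<Longrightarrow> 0 \<le> S \<Longrightarrow>
    internal_energy \<beta> \<rho> \<le> ennreal ((m + S + 2) * D)"
proof -
  obtain D where D: "(\<integral>\<^sup>+ s. level_weight \<beta> s * ennreal (sqrt s) \<partial>lborel) = ennreal D" "0 \<le> D"
    using level_weight_sqrt_finite by (cases "\<integral>\<^sup>+ s. level_weight \<beta> s * ennreal (sqrt s) \<partial>lborel") auto
  show ?thesis
  proof (rule that[OF D(2)])
    fix m \<rho> S assume *: "\<rho> \<in> M2 m" "0 \<le> m" "(\<integral>\<^sup>+ x. ennreal (x\<^sup>2) \<partial>\<rho>) \<le> ennreal S" "0 \<le> S"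
    have "internal_energy \<beta> \<rho> \<le> (\<integral>\<^sup>+ s. ennreal (m + S + 2) * (level_weight \<beta> s * ennreal (sqrt s)) \<partial>lborel)"
      unfolding internal_energy_def using * by (intro nn_integral_mono weighted_capped_mass_bound)
    also have "\<dots> = ennreal (m + S + 2) * ennreal D" unfolding D(1)[symmetric] by (rule nn_integral_cmult) measurable
    finally show "internal_energy \<beta> \<rho> \<le> ennreal ((m + S + 2) * D)" using * D by (simp add: ennreal_mult)
  qed
qed

lemma internal_energy_concave:
  assumes \<rho>: "\<rho> \<in> M2 m" and \<sigma>: "\<sigma> \<in> M2 m" and m: "0 < m" and \<theta>: "0 < \<theta>" "\<theta> < 1"
  shows "ennreal (1 - \<theta>) * internal_energy \<beta> \<rho> + ennreal \<theta> * internal_energy \<beta> \<sigma>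
     \<le> internal_energy \<beta> (displacement_interpolation \<rho> \<sigma> \<theta>)"
proof -
  note [measurable] = weighted_capped_mass_measurable[OF \<rho>] weighted_capped_mass_measurable[OF \<sigma>]
  have "ennreal (1 - \<theta>) * internal_energy \<beta> \<rho> + ennreal \<theta> * internal_energy \<beta> \<sigma>
      = (\<integral>\<^sup>+ s. ennreal (1 - \<theta>) * (level_weight \<beta> s * capped_mass s \<rho>) + ennreal \<theta> * (level_weight \<beta> s * capped_mass s \<sigma>) \<partial>lborel)"
    unfolding internal_energy_def by (subst nn_integral_add) (auto simp: nn_integral_cmult)
  also have "\<dots> \<le> internal_energy \<beta> (displacement_interpolation \<rho> \<sigma> \<theta>)"
    unfolding internal_energy_def
  proof (rule nn_integral_mono)
    fix s
    show "ennreal (1 - \<theta>) * (level_weight \<beta> s * capped_mass s \<rho>) + ennreal \<theta> * (level_weight \<beta> s * capped_mass s \<sigma>)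
        \<le> level_weight \<beta> s * capped_mass s (displacement_interpolation \<rho> \<sigma> \<theta>)"
    proof (cases "s \<le> 0")
      case False
      have "ennreal (1 - \<theta>) * capped_mass s \<rho> + ennreal \<theta> * capped_mass s \<sigma> \<le> capped_mass s (displacement_interpolation \<rho> \<sigma> \<theta>)"
        using capped_mass_concave[OF _ _ quantile_measurable[OF \<rho> m] quantile_measurable[OF \<sigma> m] \<theta>, of s]
          mono_on_quantile[OF \<rho> m] mono_on_quantile[OF \<sigma> m] False
        by (simp add: distr_quantile[OF \<rho> m] distr_quantile[OF \<sigma> m] displacement_interpolation_eq[OF \<rho> \<sigma> m] space_restrict_space)
      then have "level_weight \<beta> s * (ennreal (1 - \<theta>) * capped_mass s \<rho> + ennreal \<theta> * capped_mass s \<sigma>)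
          \<le> level_weight \<beta> s * capped_mass s (displacement_interpolation \<rho> \<sigma> \<theta>)"
        by (intro mult_left_mono) auto
      then show ?thesis by (simp add: distrib_left mult.left_commute)
    qed (simp add: level_weight_def)
  qed
  finally show ?thesis .
qed

end

text \<open>
  Reverse Fatou along a sequence that would violate the claim: each layer is upper
  semicontinuous, and \<open>weighted_capped_mass_bound\<close> provides a common integrable majorant because second
  moments stay bounded.
\<close>

lemma internal_energy_usc:
  fixes \<beta> :: "real \<Rightarrow> real"
  assumes \<beta>: "C1_on {0..} \<beta>" "strict_mono_on {0..} \<beta>" "\<beta> 0 = 0" "(\<beta> \<longlongrightarrow> \<beta>_inf) at_top"
    and \<rho>: "\<rho> \<in> M2 m" and m: "0 < m" and e: "0 < e"
  shows "\<exists>\<delta>>0. \<forall>\<sigma>\<in>M2 m. W2 \<rho> \<sigma> < \<delta> \<longrightarrow> internal_energy \<beta> \<sigma> \<le> internal_energy \<beta> \<rho> + ennreal e"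
proof (rule ccontr)
  assume "\<not> ?thesis"
  then have "\<exists>\<sigma>\<in>M2 m. W2 \<rho> \<sigma> < 1 / Suc n \<and> internal_energy \<beta> \<rho> + ennreal e < internal_energy \<beta> \<sigma>" for n :: nat
    by (auto simp: not_le dest!: spec[of _ "1 / Suc n"])
  then obtain \<sigma> where \<sigma>: "\<And>n. \<sigma> n \<in> M2 m" "\<And>n. W2 \<rho> (\<sigma> n) < 1 / Suc n"
    "\<And>n. internal_energy \<beta> \<rho> + ennreal e < internal_energy \<beta> (\<sigma> n)" by metis
  obtain S where S: "0 \<le> S" "(\<integral>\<^sup>+ x. ennreal (x\<^sup>2) \<partial>\<rho>) = ennreal S" by (rule M2_second_moment[OF \<rho>])
  have S': "(\<integral>\<^sup>+ x. ennreal (x\<^sup>2) \<partial>(\<sigma> n)) \<le> ennreal (S + 1 * (S + 2))" for n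
  proof -
    have "1 / real (Suc n) \<le> 1" by simp
    with \<sigma>(2)[of n] have "W2 \<rho> (\<sigma> n) < 1" by linarith
    then show ?thesis using S by (intro second_moment_W2[OF \<rho> \<sigma>(1) m]) auto
  qed
  let ?g = "\<lambda>\<rho> s. level_weight \<beta> s * capped_mass s \<rho>"
  let ?w = "\<lambda>s. ennreal (m + (S + 1 * (S + 2)) + 2) * (level_weight \<beta> s * ennreal (sqrt s))"
  have limsup_le: "limsup (\<lambda>n. ?g (\<sigma> n) s) \<le> ?g \<rho> s" for s
  proof (cases "s \<le> 0")
    case True
    then show ?thesis by (simp add: level_weight_def Limsup_const)
  next
    case False
    have fin: "capped_mass s \<nu> \<le> ennreal m" if "\<nu> \<in> M2 m" for \<nu>
      using capped_mass_le_mass[OF M2_D(1)[OF that], of s] M2_D(2)[OF that] by simp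
    obtain t where t: "level_weight \<beta> s = ennreal t" "0 \<le> t"
      using level_weight_alt[OF \<beta>, of s] by (metis ennreal_neg ennreal_0 linear order_refl)
    obtain p where p: "capped_mass s \<rho> = ennreal p" "0 \<le> p"
      using fin[OF \<rho>] by (cases "capped_mass s \<rho>") (auto simp: top_unique)
    obtain q where q: "\<And>n. capped_mass s (\<sigma> n) = ennreal (q n)" "\<And>n. 0 \<le> q n"
    proof (rule that)
      show "capped_mass s (\<sigma> n) = ennreal (enn2real (capped_mass s (\<sigma> n)))" for n
        using fin[OF \<sigma>(1)[of n]] by (cases "capped_mass s (\<sigma> n)") (auto simp: top_unique)
    qed auto
    show ?thesis
      unfolding Limsup_le_iff
    proof (intro allI impI)
      fix y assume y: "?g \<rho> s < y"
      show "eventually (\<lambda>n. ?g (\<sigma> n) s < y) sequentially"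
      proof (cases "t = 0 \<or> y = \<infinity>")
        case True
        then show ?thesis using y by (auto simp: t(1) q(1) ennreal_mult_less_top)
      next
        case False
        then obtain y' where y': "y = ennreal y'" "0 \<le> y'" by (cases y) auto
        have tp: "t > 0" using False t by simp
        have "t * p < y'" using y t p y' by (simp add: ennreal_less_iff flip: ennreal_mult)
        then have "capped_mass s \<rho> < ennreal (y' / t)"
          using tp p by (simp add: ennreal_less_iff field_simps)
        then obtain \<delta> where \<delta>: "\<delta> > 0"
          "\<And>\<sigma> \<gamma>. \<sigma> \<in> M2 m \<Longrightarrow> \<gamma> \<in> couplings \<rho> \<sigma> \<Longrightarrow> transport_cost \<gamma> < ennreal (\<delta>\<^sup>2) \<Longrightarrow> capped_mass s \<sigma> < ennreal (y' / t)"
          using capped_mass_usc[OF \<rho>, of s] \<open>\<not> s \<le> 0\<close> by (metis not_le)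
        obtain N :: nat where N: "1 / Suc N < \<delta>" using \<delta>(1) nat_approx_posE by blast
        show ?thesis
          unfolding eventually_sequentially
        proof (intro exI[of _ N] allI impI)
          fix n assume "N \<le> n"
          then have "1 / real (Suc n) \<le> 1 / real (Suc N)" by (simp add: frac_le)
          with \<sigma>(2)[of n] N have W: "W2 \<rho> (\<sigma> n) < \<delta>" by linarith
          have "capped_mass s (\<sigma> n) < ennreal (y' / t)"
            by (rule \<delta>(2)[OF \<sigma>(1) quantile_coupling_in_couplings[OF \<rho> \<sigma>(1) m] transport_cost_less[OF \<rho> \<sigma>(1) m W]])
          then show "?g (\<sigma> n) s < y"
            using tp y' t q by (simp add: ennreal_less_iff field_simps flip: ennreal_mult)
        qed
      qed
    qed
  qed
  have w_fin: "(\<integral>\<^sup>+ s. ?w s \<partial>lborel) < \<infinity>"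
  proof -
    note [measurable] = level_weight_measurable[OF \<beta>]
    have "(\<integral>\<^sup>+ s. ?w s \<partial>lborel) = ennreal (m + (S + 1 * (S + 2)) + 2) * (\<integral>\<^sup>+ s. level_weight \<beta> s * ennreal (sqrt s) \<partial>lborel)"
      by (rule nn_integral_cmult) measurable
    then show ?thesis using level_weight_sqrt_finite[OF \<beta>] by (simp add: ennreal_mult_less_top)
  qed
  have "internal_energy \<beta> \<rho> + ennreal e \<le> limsup (\<lambda>n. internal_energy \<beta> (\<sigma> n))"
    using \<sigma>(3) by (intro le_Limsup always_eventually) (auto intro: less_imp_le)
  also have "\<dots> \<le> (\<integral>\<^sup>+ s. limsup (\<lambda>n. ?g (\<sigma> n) s) \<partial>lborel)"
    unfolding internal_energy_def
  proof (rule nn_integral_limsup[OF _ _ _ w_fin])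
    show "?g (\<sigma> n) \<in> borel_measurable lborel" for n by (rule weighted_capped_mass_measurable[OF \<beta> \<sigma>(1)])
    note [measurable] = level_weight_measurable[OF \<beta>]
    show "?w \<in> borel_measurable lborel" by measurable
    show "AE s in lborel. ?g (\<sigma> n) s \<le> ?w s" for n
      using weighted_capped_mass_bound[OF \<beta> \<sigma>(1) _ S'] S m by (intro AE_I2) auto
  qed
  also have "\<dots> \<le> internal_energy \<beta> \<rho>"
    unfolding internal_energy_def using limsup_le by (intro nn_integral_mono)
  finally have le: "internal_energy \<beta> \<rho> + ennreal e \<le> internal_energy \<beta> \<rho>" .
  obtain D where "0 \<le> D" "\<And>m \<rho> S. \<rho> \<in> M2 m \<Longrightarrow> 0 \<le> m \<Longrightarrow> (\<integral>\<^sup>+ x. ennreal (x\<^sup>2) \<partial>\<rho>) \<le> ennreal S \<Longrightarrow> 0 \<le> S \<Longrightarrow>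
    internal_energy \<beta> \<rho> \<le> ennreal ((m + S + 2) * D)" by (rule internal_energy_bound[OF \<beta>]) blast
  then have "internal_energy \<beta> \<rho> \<le> ennreal ((m + S + 2) * D)" using \<rho> m S by simp
  then obtain i where "internal_energy \<beta> \<rho> = ennreal i" "0 \<le> i" by (cases "internal_energy \<beta> \<rho>") (auto simp: top_unique)
  with le e show False by (simp flip: ennreal_plus)
qed

section \<open>The potential energy\<close>

lemma integrable_imp_ext_integral:
  assumes "integrable M (f :: 'a \<Rightarrow> real)"
  shows "ext_integral M f = ereal (\<integral>x. f x \<partial>M)"
proof -
  have "(\<integral>\<^sup>+ x. ennreal (f x) \<partial>M) < \<infinity>" "(\<integral>\<^sup>+ x. ennreal (- f x) \<partial>M) < \<infinity>"
    using assms by (auto simp: real_integrable_def less_top)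
  then show ?thesis
    using real_lebesgue_integral_def[OF assms] unfolding ext_integral_def
    by (cases "\<integral>\<^sup>+ x. ennreal (f x) \<partial>M"; cases "\<integral>\<^sup>+ x. ennreal (- f x) \<partial>M") auto
qed

lemma nn_integral_quadratic:
  assumes \<rho>: "\<rho> \<in> M2 m" and m: "0 < m" and S: "(\<integral>\<^sup>+ x. ennreal (x\<^sup>2) \<partial>\<rho>) = ennreal S" "0 \<le> S" and K: "0 \<le> K"
  shows "(\<integral>\<^sup>+ x. ennreal (K * (1 + x\<^sup>2)) \<partial>\<rho>) = ennreal (K * (m + S))"
proof -
  note [measurable_cong] = M2_D(1)[OF \<rho>]
  have "(\<integral>\<^sup>+ x. ennreal (K * (1 + x\<^sup>2)) \<partial>\<rho>) = (\<integral>\<^sup>+ x. ennreal K * (1 + ennreal (x\<^sup>2)) \<partial>\<rho>)"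
    using K by (intro nn_integral_cong) (simp add: ennreal_mult ennreal_plus)
  also have "\<dots> = ennreal K * (ennreal m + ennreal S)"
    using M2_D(2,5)[OF \<rho>] S(1) by (simp add: nn_integral_cmult nn_integral_add)
  finally show ?thesis using K m S by (simp add: ennreal_mult)
qed

context
  fixes V :: "real \<Rightarrow> real" and lam :: real
  assumes C2: "C2 V" and convex: "\<And>x. lam \<le> deriv (deriv V) x"
begin

lemma V_derivs: "(V has_real_derivative deriv V x) (at x)" "(deriv V has_real_derivative deriv (deriv V) x) (at x)"
  using C2 unfolding C2_def C1_on_def by (metis DERIV_imp_deriv UNIV_I)+

lemma V_measurable: "V \<in> borel_measurable borel"
  using V_derivs(1) by (intro borel_measurable_continuous_onI continuous_at_imp_continuous_on) (auto intro: DERIV_isCont)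

lemma tilted_potential_deriv: "((\<lambda>x. V x - lam / 2 * x\<^sup>2) has_real_derivative deriv V x - lam * x) (at x)"
  using V_derivs(1) by (auto intro!: derivative_eq_intros)

lemma tilted_potential_convex: "convex_on UNIV (\<lambda>x. V x - lam / 2 * x\<^sup>2)"
proof (rule f''_ge0_imp_convex)
  show "((\<lambda>x. V x - lam / 2 * x\<^sup>2) has_real_derivative deriv V x - lam * x) (at x)" for x by (rule tilted_potential_deriv)
  show "((\<lambda>x. deriv V x - lam * x) has_real_derivative deriv (deriv V) x - lam) (at x)" for x
    using V_derivs(2) by (auto intro!: derivative_eq_intros)
qed (use convex in auto)

lemma V_semiconvex:
  assumes "0 \<le> \<theta>" "\<theta> \<le> 1"
  shows "V ((1 - \<theta>) * x + \<theta> * y) \<le> (1 - \<theta>) * V x + \<theta> * V y - lam / 2 * \<theta> * (1 - \<theta>) * (x - y)\<^sup>2"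
proof -
  have "lam / 2 * ((1 - \<theta>) * x + \<theta> * y)\<^sup>2
      = (1 - \<theta>) * (lam / 2 * x\<^sup>2) + \<theta> * (lam / 2 * y\<^sup>2) - lam / 2 * \<theta> * (1 - \<theta>) * (x - y)\<^sup>2"
    by (simp add: field_simps power2_eq_square)
  moreover have "V ((1 - \<theta>) * x + \<theta> * y) - lam / 2 * ((1 - \<theta>) * x + \<theta> * y)\<^sup>2
      \<le> (1 - \<theta>) * (V x - lam / 2 * x\<^sup>2) + \<theta> * (V y - lam / 2 * y\<^sup>2)"
    using convex_onD[OF tilted_potential_convex, of \<theta> x y] assms by simp
  ultimately show ?thesis unfolding right_diff_distrib by linarith
qed

lemma V_quadratic_lower_bound:
  obtains K where "0 \<le> K" "\<And>x. 0 \<le> V x + K * (1 + x\<^sup>2)"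
proof -
  define K where "K = \<bar>V 0\<bar> + \<bar>deriv V 0\<bar> + \<bar>lam\<bar>"
  have "0 \<le> V x + K * (1 + x\<^sup>2)" for x
  proof -
    have "V x - lam / 2 * x\<^sup>2 - (V 0 - lam / 2 * 0\<^sup>2) \<ge> (deriv V 0 - lam * 0) * (x - 0)"
      using tilted_potential_deriv[of 0] by (intro convex_on_imp_above_tangent[OF tilted_potential_convex]) auto
    then have 1: "V x \<ge> V 0 + deriv V 0 * x + lam / 2 * x\<^sup>2" by simp
    have "\<bar>x\<bar> \<le> 1 + x\<^sup>2"
      using zero_le_power2[of "\<bar>x\<bar> - 1"] zero_le_power2[of x] by (simp add: power2_diff)
    then have "\<bar>deriv V 0 * x\<bar> \<le> \<bar>deriv V 0\<bar> * (1 + x\<^sup>2)" unfolding abs_mult by (intro mult_left_mono) auto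
    moreover have "\<bar>lam / 2 * x\<^sup>2\<bar> \<le> \<bar>lam\<bar> * (1 + x\<^sup>2)"
      unfolding abs_mult by (intro mult_mono) auto
    moreover have "\<bar>V 0\<bar> * 1 \<le> \<bar>V 0\<bar> * (1 + x\<^sup>2)" by (intro mult_left_mono) auto
    moreover have "K * (1 + x\<^sup>2) = \<bar>V 0\<bar> * (1 + x\<^sup>2) + \<bar>deriv V 0\<bar> * (1 + x\<^sup>2) + \<bar>lam\<bar> * (1 + x\<^sup>2)"
      by (simp add: K_def distrib_right)
    ultimately show ?thesis using 1 by linarith
  qed
  moreover have "0 \<le> K" by (simp add: K_def)
  ultimately show ?thesis using that by blast
qed

text \<open>
  Adding the integrable function \<open>K * (1 + x\<^sup>2)\<close> turns the extended integral into that of a nonnegative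
  function, to which monotone convergence and semicontinuity results apply.
\<close>

lemma ext_integral_V_eq:
  assumes \<rho>: "\<rho> \<in> M2 m" and m: "0 < m" and S: "(\<integral>\<^sup>+ x. ennreal (x\<^sup>2) \<partial>\<rho>) = ennreal S" "0 \<le> S"
    and K: "0 \<le> K" "\<And>x. 0 \<le> V x + K * (1 + x\<^sup>2)"
  shows "ext_integral \<rho> V = enn2ereal (\<integral>\<^sup>+ x. ennreal (V x + K * (1 + x\<^sup>2)) \<partial>\<rho>) - ereal (K * (m + S))"
    and "(\<integral>\<^sup>+ x. ennreal (- V x) \<partial>\<rho>) < \<infinity>"
proof -
  note [measurable] = V_measurable and [measurable_cong] = M2_D(1)[OF \<rho>]
  define P N T where "P = (\<integral>\<^sup>+ x. ennreal (V x) \<partial>\<rho>)" and "N = (\<integral>\<^sup>+ x. ennreal (- V x) \<partial>\<rho>)"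
    and "T = (\<integral>\<^sup>+ x. ennreal (V x + K * (1 + x\<^sup>2)) \<partial>\<rho>)"
  let ?G = "K * (m + S)"
  have G: "(\<integral>\<^sup>+ x. ennreal (K * (1 + x\<^sup>2)) \<partial>\<rho>) = ennreal ?G" by (rule nn_integral_quadratic[OF \<rho> m S K(1)])
  have G0: "0 \<le> ?G" using K m S by simp
  have "N \<le> ennreal ?G"
    unfolding N_def G[symmetric]
  proof (intro nn_integral_mono ennreal_leI)
    show "- V x \<le> K * (1 + x\<^sup>2)" for x using K(2)[of x] by linarith
  qed
  then obtain n where n: "N = ennreal n" "0 \<le> n" by (cases N) (auto simp: top_unique)
  then show "(\<integral>\<^sup>+ x. ennreal (- V x) \<partial>\<rho>) < \<infinity>" by (simp add: N_def)
  have "P + ennreal ?G = (\<integral>\<^sup>+ x. ennreal (V x) + ennreal (K * (1 + x\<^sup>2)) \<partial>\<rho>)"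
    unfolding P_def G[symmetric] by (rule nn_integral_add[symmetric]) measurable
  also have "\<dots> = (\<integral>\<^sup>+ x. ennreal (V x + K * (1 + x\<^sup>2)) + ennreal (- V x) \<partial>\<rho>)"
  proof (rule nn_integral_cong)
    fix x
    have q: "0 \<le> K * (1 + x\<^sup>2)" using K by simp
    show "ennreal (V x) + ennreal (K * (1 + x\<^sup>2)) = ennreal (V x + K * (1 + x\<^sup>2)) + ennreal (- V x)"
      using K(2)[of x] q by (cases "0 \<le> V x") (simp_all add: ennreal_neg flip: ennreal_plus)
  qed
  also have "\<dots> = T + N" unfolding T_def N_def by (rule nn_integral_add) measurable
  finally have eq: "P + ennreal ?G = T + ennreal n" by (simp add: n)
  have "enn2ereal P - enn2ereal N = enn2ereal T - ereal ?G"
  proof (cases "P = \<infinity>")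
    case True
    then have "T = \<infinity>" using eq by (metis ennreal_add_eq_top ennreal_neq_top infinity_ennreal_def top_add)
    then show ?thesis using True n by simp
  next
    case False
    then obtain p where p: "P = ennreal p" "0 \<le> p" by (cases P) auto
    then obtain t where t: "T = ennreal t" "0 \<le> t" using eq G0 by (cases T) (auto simp flip: ennreal_plus)
    have "p + ?G = t + n" using eq p t n G0 by (simp flip: ennreal_plus)
    then show ?thesis using p t n by simp
  qed
  then show "ext_integral \<rho> V = enn2ereal (\<integral>\<^sup>+ x. ennreal (V x + K * (1 + x\<^sup>2)) \<partial>\<rho>) - ereal ?G"
    by (simp add: ext_integral_def P_def N_def T_def)
qed

lemma ext_integral_V_lower_bound:
  obtains K where "0 \<le> K" "\<And>m \<rho> S. \<rho> \<in> M2 m \<Longrightarrow> 0 < m \<Longrightarrow> (\<integral>\<^sup>+ x. ennreal (x\<^sup>2) \<partial>\<rho>) \<le> ennreal S \<Longrightarrow> 0 \<le> S \<Longrightarrow>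
    ereal (- (K * (m + S))) \<le> ext_integral \<rho> V"
proof -
  obtain K where K: "0 \<le> K" "\<And>x. 0 \<le> V x + K * (1 + x\<^sup>2)" by (rule V_quadratic_lower_bound) blast
  show ?thesis
  proof (rule that[OF K(1)])
    fix m \<rho> S assume *: "\<rho> \<in> M2 m" "0 < m" "(\<integral>\<^sup>+ x. ennreal (x\<^sup>2) \<partial>\<rho>) \<le> ennreal S" "0 \<le> S"
    obtain S' where S': "0 \<le> S'" "(\<integral>\<^sup>+ x. ennreal (x\<^sup>2) \<partial>\<rho>) = ennreal S'" by (rule M2_second_moment[OF *(1)])
    then have "S' \<le> S" using * by simp
    then have "K * (m + S') \<le> K * (m + S)" using K by (intro mult_left_mono) auto
    then have "ereal (- (K * (m + S))) \<le> 0 - ereal (K * (m + S'))" by simp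
    also have "\<dots> \<le> ext_integral \<rho> V"
      unfolding ext_integral_V_eq(1)[OF *(1,2) S'(2,1) K] by (intro ereal_minus_mono) auto
    finally show "ereal (- (K * (m + S))) \<le> ext_integral \<rho> V" .
  qed
qed

text \<open>
  The integral of the nonnegative continuous function \<open>V x + K * (1 + x\<^sup>2)\<close> is lower
  semicontinuous, and the second moment that has to be subtracted is upper semicontinuous.
\<close>

lemma ext_integral_V_lsc:
  assumes \<rho>: "\<rho> \<in> M2 m" and m: "0 < m" and b: "ereal b < ext_integral \<rho> V"
  shows "\<exists>\<delta>>0. \<forall>\<sigma>\<in>M2 m. W2 \<rho> \<sigma> < \<delta> \<longrightarrow> ereal b < ext_integral \<sigma> V"
proof -
  obtain K where K: "0 \<le> K" "\<And>x. 0 \<le> V x + K * (1 + x\<^sup>2)" by (rule V_quadratic_lower_bound) blast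
  let ?f = "\<lambda>x. V x + K * (1 + x\<^sup>2)"
  obtain S where S: "0 \<le> S" "(\<integral>\<^sup>+ x. ennreal (x\<^sup>2) \<partial>\<rho>) = ennreal S" by (rule M2_second_moment[OF \<rho>])
  let ?T = "\<lambda>\<sigma>. \<integral>\<^sup>+ x. ennreal (?f x) \<partial>\<sigma>"
  have "ereal b < enn2ereal (?T \<rho>) - ereal (K * (m + S))"
    using b ext_integral_V_eq(1)[OF \<rho> m S(2,1) K] by simp
  then have "ereal (b + K * (m + S)) < enn2ereal (?T \<rho>)" by (cases "?T \<rho>") auto
  then obtain c where c: "b + K * (m + S) < c" "ereal c < enn2ereal (?T \<rho>)"
    using ereal_dense2[of "ereal (b + K * (m + S))" "enn2ereal (?T \<rho>)"] by auto
  \<comment> \<open>\<open>c\<close> may be negative, in which case every measure satisfies the bound.\<close>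
  have "\<exists>\<delta>>0. \<forall>\<sigma>\<in>M2 m. W2 \<rho> \<sigma> < \<delta> \<longrightarrow> ereal c < enn2ereal (?T \<sigma>)"
  proof (cases "c < 0")
    case True
    then have "ereal c < enn2ereal (?T \<sigma>)" for \<sigma> using enn2ereal_nonneg[of "?T \<sigma>"] by (meson ereal_less(2) less_le_trans not_le ereal_less_eq(5))
    then show ?thesis by (intro exI[of _ 1]) auto
  next
    case False
    then have iff: "ereal c < enn2ereal X \<longleftrightarrow> ennreal c < X" for X
      by (simp add: less_ennreal.rep_eq max_absorb2 flip: enn2ereal_ennreal)
    have cont: "continuous_on UNIV ?f"
      using V_derivs(1) by (intro continuous_intros continuous_at_imp_continuous_on) (auto intro: DERIV_isCont)
    have lsc: "eventually (\<lambda>y. a < ?f y) (nhds x)" if "a < ?f x" for a x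
    proof -
      have "isCont ?f x" using cont by (simp add: continuous_on_eq_continuous_at)
      then have "(?f \<longlongrightarrow> ?f x) (nhds x)" unfolding isCont_def by (rule tendsto_at_iff_tendsto_nhds[THEN iffD1])
      then show ?thesis using that by (rule order_tendstoD)
    qed
    obtain \<delta> where \<delta>: "\<delta> > 0" "\<And>\<sigma> \<gamma>. \<gamma> \<in> couplings \<rho> \<sigma> \<Longrightarrow> transport_cost \<gamma> < ennreal (\<delta>\<^sup>2) \<Longrightarrow> ennreal c < ?T \<sigma>"
      using nn_integral_lsc[OF K(2) lsc \<rho>, of "ennreal c"] c(2) iff by blast
    show ?thesis
      unfolding iff
    proof (intro exI[of _ \<delta>] conjI \<delta>(1) ballI impI)
      fix \<sigma> assume \<sigma>: "\<sigma> \<in> M2 m" "W2 \<rho> \<sigma> < \<delta>"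
      then show "ennreal c < ?T \<sigma>"
        by (intro \<delta>(2)[OF quantile_coupling_in_couplings[OF \<rho> \<sigma>(1) m]] transport_cost_less[OF \<rho> \<sigma>(1) m])
    qed
  qed
  then obtain \<delta>1 where \<delta>1: "\<delta>1 > 0" "\<And>\<sigma>. \<sigma> \<in> M2 m \<Longrightarrow> W2 \<rho> \<sigma> < \<delta>1 \<Longrightarrow> ereal c < enn2ereal (?T \<sigma>)" by blast
  define g where "g = c - (b + K * (m + S))"
  \<comment> \<open>The second moment exceeds \<open>S\<close> by at most \<open>\<delta>2 * (S + 2)\<close>, which must cost no more than the gap \<open>g\<close>.\<close>
  define \<delta>2 where "\<delta>2 = min 1 (g / (K * (S + 2) + 1))"
  have den: "0 < K * (S + 2) + 1" using K S by (intro add_nonneg_pos) auto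
  have \<delta>2: "0 < \<delta>2" "\<delta>2 \<le> 1" using c den by (auto simp: \<delta>2_def g_def)
  have \<delta>2': "K * (\<delta>2 * (S + 2)) \<le> g"
  proof -
    have "\<delta>2 * (K * (S + 2) + 1) \<le> g" using den by (simp add: \<delta>2_def min_le_iff_disj pos_le_divide_eq[symmetric])
    then show ?thesis using \<delta>2 by (simp add: algebra_simps)
  qed
  show ?thesis
  proof (intro exI[of _ "min \<delta>1 \<delta>2"] conjI ballI impI)
    show "0 < min \<delta>1 \<delta>2" using \<delta>1 \<delta>2 by simp
    fix \<sigma> assume \<sigma>: "\<sigma> \<in> M2 m" and W: "W2 \<rho> \<sigma> < min \<delta>1 \<delta>2"
    obtain S' where S': "0 \<le> S'" "(\<integral>\<^sup>+ x. ennreal (x\<^sup>2) \<partial>\<sigma>) = ennreal S'" by (rule M2_second_moment[OF \<sigma>])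
    have "ennreal S' \<le> ennreal (S + \<delta>2 * (S + 2))"
      using second_moment_W2[OF \<rho> \<sigma> m _ \<delta>2(2), of S] W S S' by simp
    then have "S' \<le> S + \<delta>2 * (S + 2)" using S \<delta>2 by (subst (asm) ennreal_le_iff) auto
    then have "K * S' \<le> K * (S + \<delta>2 * (S + 2))" using K by (intro mult_left_mono)
    then have "b + K * (m + S') \<le> c" using \<delta>2' by (simp add: g_def algebra_simps)
    then have "ereal (b + K * (m + S')) < enn2ereal (?T \<sigma>)"
      using \<delta>1(2)[OF \<sigma>] W by (meson ereal_less_eq(3) le_less_trans min_less_iff_conj)
    then show "ereal b < ext_integral \<sigma> V"
      unfolding ext_integral_V_eq(1)[OF \<sigma> m S'(2,1) K] by (cases "?T \<sigma>") auto
  qed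
qed

lemma ext_integral_finite_imp_integrable:
  assumes \<rho>: "\<rho> \<in> M2 m" and m: "0 < m" and fin: "ext_integral \<rho> V < \<infinity>"
  shows "integrable \<rho> V"
proof -
  note [measurable] = V_measurable and [measurable_cong] = M2_D(1)[OF \<rho>]
  obtain K where K: "0 \<le> K" "\<And>x. 0 \<le> V x + K * (1 + x\<^sup>2)" by (rule V_quadratic_lower_bound) blast
  obtain S where S: "0 \<le> S" "(\<integral>\<^sup>+ x. ennreal (x\<^sup>2) \<partial>\<rho>) = ennreal S" by (rule M2_second_moment[OF \<rho>])
  have N: "(\<integral>\<^sup>+ x. ennreal (- V x) \<partial>\<rho>) < \<infinity>" by (rule ext_integral_V_eq(2)[OF \<rho> m S(2,1) K])
  have "(\<integral>\<^sup>+ x. ennreal (V x) \<partial>\<rho>) < \<infinity>"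
    using fin N unfolding ext_integral_def
    by (cases "\<integral>\<^sup>+ x. ennreal (V x) \<partial>\<rho>"; cases "\<integral>\<^sup>+ x. ennreal (- V x) \<partial>\<rho>") auto
  with N show ?thesis by (auto simp: real_integrable_def)
qed

end

lemma integrable_quantile_iff:
  assumes \<rho>: "\<rho> \<in> M2 m" and m: "0 < m" and [measurable]: "f \<in> borel_measurable borel"
  shows "integrable (levels m) (\<lambda>w. f (quantile \<rho> w)) \<longleftrightarrow> integrable \<rho> (f :: real \<Rightarrow> real)"
    and "(\<integral>w. f (quantile \<rho> w) \<partial>(levels m)) = (\<integral>x. f x \<partial>\<rho>)"
proof -
  note [measurable] = quantile_measurable[OF \<rho> m]
  show "integrable (levels m) (\<lambda>w. f (quantile \<rho> w)) \<longleftrightarrow> integrable \<rho> f"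
    by (subst (2) distr_quantile[OF \<rho> m, symmetric], subst integrable_distr_eq) auto
  show "(\<integral>w. f (quantile \<rho> w) \<partial>(levels m)) = (\<integral>x. f x \<partial>\<rho>)"
    by (subst (2) distr_quantile[OF \<rho> m, symmetric], subst integral_distr) auto
qed

lemma integrable_square_M2: "\<rho> \<in> M2 m \<Longrightarrow> integrable \<rho> (\<lambda>x. x\<^sup>2)"
  using M2_D(1,4)[of \<rho> m] by (intro integrableI_nonneg) (auto cong: measurable_cong_sets)

lemma interpolation_square_le: "0 \<le> \<theta> \<Longrightarrow> \<theta> \<le> 1 \<Longrightarrow> ((1 - \<theta>) * x + \<theta> * y)\<^sup>2 \<le> x\<^sup>2 + (y::real)\<^sup>2"
proof -
  assume \<theta>: "0 \<le> \<theta>" "\<theta> \<le> 1"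
  have "((1 - \<theta>) * x + \<theta> * y)\<^sup>2 = (1 - \<theta>) * x\<^sup>2 + \<theta> * y\<^sup>2 - \<theta> * (1 - \<theta>) * (x - y)\<^sup>2"
    by (simp add: algebra_simps power2_eq_square)
  also have "\<dots> \<le> (1 - \<theta>) * x\<^sup>2 + \<theta> * y\<^sup>2" using \<theta> by simp
  also have "\<dots> \<le> x\<^sup>2 + y\<^sup>2" using \<theta> by (intro add_mono mult_left_le_one_le) auto
  finally show ?thesis .
qed

lemma displacement_interpolation_M2:
  assumes \<rho>: "\<rho> \<in> M2 m" and \<sigma>: "\<sigma> \<in> M2 m" and m: "0 < m" and \<theta>: "0 \<le> \<theta>" "\<theta> \<le> 1"
  shows "displacement_interpolation \<rho> \<sigma> \<theta> \<in> M2 m"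
proof -
  note [measurable] = quantile_measurable[OF \<rho> m] quantile_measurable[OF \<sigma> m]
  define Z where "Z w = (1 - \<theta>) * quantile \<rho> w + \<theta> * quantile \<sigma> w" for w
  have [measurable]: "Z \<in> borel_measurable (levels m)" unfolding Z_def by measurable
  have eq: "displacement_interpolation \<rho> \<sigma> \<theta> = distr (levels m) borel Z"
    unfolding Z_def by (rule displacement_interpolation_eq[OF \<rho> \<sigma> m])
  have "emeasure (distr (levels m) borel Z) UNIV = ennreal m"
    using m by (simp add: emeasure_distr emeasure_restrict_space space_restrict_space)
  moreover have "(\<integral>\<^sup>+ x. ennreal (x\<^sup>2) \<partial>(distr (levels m) borel Z)) < \<infinity>"
  proof -
    have sq: "(\<integral>\<^sup>+ w. ennreal ((quantile \<nu> w)\<^sup>2) \<partial>(levels m)) < \<infinity>" if "\<nu> \<in> M2 m" for \<nu>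
    proof -
      have "(\<integral>\<^sup>+ x. ennreal (x\<^sup>2) \<partial>(distr (levels m) borel (quantile \<nu>))) = (\<integral>\<^sup>+ w. ennreal ((quantile \<nu> w)\<^sup>2) \<partial>(levels m))"
        by (rule nn_integral_distr[OF quantile_measurable[OF that m]]) simp
      then show ?thesis using M2_D(4)[OF that] by (simp add: distr_quantile[OF that m])
    qed
    have "(\<integral>\<^sup>+ x. ennreal (x\<^sup>2) \<partial>(distr (levels m) borel Z)) = (\<integral>\<^sup>+ w. ennreal ((Z w)\<^sup>2) \<partial>(levels m))"
      by (rule nn_integral_distr) measurable
    also have "\<dots> \<le> (\<integral>\<^sup>+ w. ennreal ((quantile \<rho> w)\<^sup>2) + ennreal ((quantile \<sigma> w)\<^sup>2) \<partial>(levels m))"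
      using interpolation_square_le[OF \<theta>] by (intro nn_integral_mono) (auto simp: Z_def intro!: ennreal_leI simp flip: ennreal_plus)
    also have "\<dots> = (\<integral>\<^sup>+ w. ennreal ((quantile \<rho> w)\<^sup>2) \<partial>(levels m)) + (\<integral>\<^sup>+ w. ennreal ((quantile \<sigma> w)\<^sup>2) \<partial>(levels m))"
      by (rule nn_integral_add) measurable
    also have "\<dots> < \<infinity>" using sq[OF \<rho>] sq[OF \<sigma>] by simp
    finally show ?thesis .
  qed
  ultimately show ?thesis unfolding eq M2_def by simp
qed

lemma W2_squared_quantile:
  assumes \<rho>: "\<rho> \<in> M2 m" and \<sigma>: "\<sigma> \<in> M2 m" and m: "0 < m"
  shows "integrable (levels m) (\<lambda>w. (quantile \<rho> w - quantile \<sigma> w)\<^sup>2)"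
    and "(\<integral>w. (quantile \<rho> w - quantile \<sigma> w)\<^sup>2 \<partial>(levels m)) = (W2 \<rho> \<sigma>)\<^sup>2"
proof -
  note [measurable] = quantile_measurable[OF \<rho> m] quantile_measurable[OF \<sigma> m]
  have "(\<integral>\<^sup>+ w. ennreal ((quantile \<rho> w - quantile \<sigma> w)\<^sup>2) \<partial>(levels m)) = transport_cost (quantile_coupling m \<rho> \<sigma>)"
    unfolding transport_cost_eq quantile_coupling_def
    by (subst nn_integral_distr) (auto simp: borel_prod[symmetric])
  also have "\<dots> = ennreal ((W2 \<rho> \<sigma>)\<^sup>2)" by (rule transport_cost_quantile[OF \<rho> \<sigma> m])
  finally have *: "(\<integral>\<^sup>+ w. ennreal ((quantile \<rho> w - quantile \<sigma> w)\<^sup>2) \<partial>(levels m)) = ennreal ((W2 \<rho> \<sigma>)\<^sup>2)" .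
  then show "integrable (levels m) (\<lambda>w. (quantile \<rho> w - quantile \<sigma> w)\<^sup>2)"
    by (intro integrableI_nonneg) auto
  show "(\<integral>w. (quantile \<rho> w - quantile \<sigma> w)\<^sup>2 \<partial>(levels m)) = (W2 \<rho> \<sigma>)\<^sup>2"
    by (subst integral_eq_nn_integral) (auto simp: *)
qed

text \<open>
  Integrate the semiconvexity inequality of \<open>V\<close> along \<open>X\<close>, \<open>Y\<close> and \<open>Z\<close> over the levels; the
  quadratic term integrates to the Wasserstein distance because the quantile coupling is optimal. The
  lower bound of \<open>V\<close> makes \<open>V \<circ> Z\<close> integrable.
\<close>

lemma ext_integral_V_convex:
  assumes V: "C2 V" "\<And>x. lam \<le> deriv (deriv V) x"
    and \<rho>: "\<rho> \<in> M2 m" and \<sigma>: "\<sigma> \<in> M2 m" and m: "0 < m" and \<theta>: "0 \<le> \<theta>" "\<theta> \<le> 1"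
    and int: "integrable \<rho> V" "integrable \<sigma> V"
  shows "ext_integral (displacement_interpolation \<rho> \<sigma> \<theta>) V \<le>
    ereal ((1 - \<theta>) * (\<integral>x. V x \<partial>\<rho>) + \<theta> * (\<integral>x. V x \<partial>\<sigma>) - lam / 2 * \<theta> * (1 - \<theta>) * (W2 \<rho> \<sigma>)\<^sup>2)"
proof -
  note [measurable] = quantile_measurable[OF \<rho> m] quantile_measurable[OF \<sigma> m] V_measurable[OF V]
  interpret finite_measure "levels m" by (rule finite_measure_levels[OF m])
  define X Y where "X = quantile \<rho>" and "Y = quantile \<sigma>"
  have [measurable]: "X \<in> borel_measurable (levels m)" "Y \<in> borel_measurable (levels m)" unfolding X_def Y_def by measurable
  define Z where "Z w = (1 - \<theta>) * X w + \<theta> * Y w" for w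
  have [measurable]: "Z \<in> borel_measurable (levels m)" unfolding Z_def by measurable
  have eq: "displacement_interpolation \<rho> \<sigma> \<theta> = distr (levels m) borel Z"
    unfolding Z_def X_def Y_def by (rule displacement_interpolation_eq[OF \<rho> \<sigma> m])
  obtain K where K: "0 \<le> K" "\<And>x. 0 \<le> V x + K * (1 + x\<^sup>2)" by (rule V_quadratic_lower_bound[OF V]) blast
  define B where "B w = (1 - \<theta>) * V (X w) + \<theta> * V (Y w) - lam / 2 * \<theta> * (1 - \<theta>) * (X w - Y w)\<^sup>2" for w
  have iV: "integrable (levels m) (\<lambda>w. V (X w))" "integrable (levels m) (\<lambda>w. V (Y w))"
    unfolding X_def Y_def using int integrable_quantile_iff(1)[OF \<rho> m, of V] integrable_quantile_iff(1)[OF \<sigma> m, of V] by auto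
  have iS: "integrable (levels m) (\<lambda>w. (X w)\<^sup>2)" "integrable (levels m) (\<lambda>w. (Y w)\<^sup>2)"
    unfolding X_def Y_def using integrable_square_M2[OF \<rho>] integrable_square_M2[OF \<sigma>]
      integrable_quantile_iff(1)[OF \<rho> m, of "\<lambda>x. x\<^sup>2"] integrable_quantile_iff(1)[OF \<sigma> m, of "\<lambda>x. x\<^sup>2"] by auto
  have iD: "integrable (levels m) (\<lambda>w. (X w - Y w)\<^sup>2)" unfolding X_def Y_def by (rule W2_squared_quantile(1)[OF \<rho> \<sigma> m])
  have iB: "integrable (levels m) B" unfolding B_def using iV iD by auto
  have up: "V (Z w) \<le> B w" for w unfolding Z_def B_def by (rule V_semiconvex[OF V \<theta>])
  have lo: "- (K * (1 + ((X w)\<^sup>2 + (Y w)\<^sup>2))) \<le> V (Z w)" for w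
  proof -
    have "K * (1 + (Z w)\<^sup>2) \<le> K * (1 + ((X w)\<^sup>2 + (Y w)\<^sup>2))"
      using K interpolation_square_le[OF \<theta>, of "X w" "Y w"] by (intro mult_left_mono) (auto simp: Z_def)
    then show ?thesis using K(2)[of "Z w"] by linarith
  qed
  have iZ: "integrable (levels m) (\<lambda>w. V (Z w))"
  proof (rule Bochner_Integration.integrable_bound)
    show "integrable (levels m) (\<lambda>w. \<bar>B w\<bar> + K * (1 + ((X w)\<^sup>2 + (Y w)\<^sup>2)))" using iB iS by auto
    show "AE w in levels m. norm (V (Z w)) \<le> norm (\<bar>B w\<bar> + K * (1 + ((X w)\<^sup>2 + (Y w)\<^sup>2)))"
    proof (rule AE_I2)
      fix w
      have "0 \<le> K * (1 + ((X w)\<^sup>2 + (Y w)\<^sup>2))" using K by simp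
      with up[of w] lo[of w] show "norm (V (Z w)) \<le> norm (\<bar>B w\<bar> + K * (1 + ((X w)\<^sup>2 + (Y w)\<^sup>2)))"
        unfolding real_norm_def by linarith
    qed
  qed measurable
  have "ext_integral (distr (levels m) borel Z) V = ereal (\<integral>x. V x \<partial>(distr (levels m) borel Z))"
    using iZ by (intro integrable_imp_ext_integral) (simp add: integrable_distr_eq)
  also have "(\<integral>x. V x \<partial>(distr (levels m) borel Z)) = (\<integral>w. V (Z w) \<partial>(levels m))" by (rule integral_distr) measurable
  also have "\<dots> \<le> (\<integral>w. B w \<partial>(levels m))" using iZ iB up by (intro integral_mono) auto
  also have "\<dots> = (1 - \<theta>) * (\<integral>w. V (X w) \<partial>(levels m)) + \<theta> * (\<integral>w. V (Y w) \<partial>(levels m))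
      - lam / 2 * \<theta> * (1 - \<theta>) * (\<integral>w. (X w - Y w)\<^sup>2 \<partial>(levels m))"
    unfolding B_def using iV iD by simp
  also have "\<dots> = (1 - \<theta>) * (\<integral>x. V x \<partial>\<rho>) + \<theta> * (\<integral>x. V x \<partial>\<sigma>) - lam / 2 * \<theta> * (1 - \<theta>) * (W2 \<rho> \<sigma>)\<^sup>2"
    unfolding X_def Y_def W2_squared_quantile(2)[OF \<rho> \<sigma> m]
    by (simp add: integrable_quantile_iff(2)[OF \<rho> m] integrable_quantile_iff(2)[OF \<sigma> m])
  finally show ?thesis unfolding eq by simp
qed

section \<open>The free energy\<close>

theorem proposition3p1:
  fixes \<beta> V :: "real \<Rightarrow> real" and \<beta>_inf lam m :: real
  assumes "C1_on {0..} \<beta>"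
    and "strict_mono_on {0..} \<beta>"
    and "\<beta> 0 = 0"
    and "(\<beta> \<longlongrightarrow> \<beta>_inf) at_top"
    and "C2 V"
    and "\<And>x. deriv (deriv V) x \<ge> lam"
    and "Liminf at_infinity (\<lambda>x. ereal (V x / \<bar>x\<bar>\<^sup>2)) \<ge> 0"
    and "m > 0"
  shows "W2_lower_semicontinuous m (F_fun \<beta> V) \<and>
    displacement_convex m lam (F_fun \<beta> V) \<and>
    (\<forall>C>0. (INF \<rho>\<in>{\<rho>\<in>M2 m. (\<integral>\<^sup>+ x. ennreal (\<bar>x\<bar>\<^sup>2) \<partial>\<rho>) \<le> ennreal C}. F_fun \<beta> V \<rho>) > -\<infinity>)"
proof -
  note \<beta> = assms(1-4) and V = assms(5,6) and m = assms(8)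
  obtain D where D: "0 \<le> D" "\<And>m \<rho> S. \<rho> \<in> M2 m \<Longrightarrow> 0 \<le> m \<Longrightarrow> (\<integral>\<^sup>+ x. ennreal (x\<^sup>2) \<partial>\<rho>) \<le> ennreal S \<Longrightarrow> 0 \<le> S \<Longrightarrow>
    internal_energy \<beta> \<rho> \<le> ennreal ((m + S + 2) * D)" by (rule internal_energy_bound[OF \<beta>]) blast
  obtain K where K: "0 \<le> K" "\<And>m \<rho> S. \<rho> \<in> M2 m \<Longrightarrow> 0 < m \<Longrightarrow> (\<integral>\<^sup>+ x. ennreal (x\<^sup>2) \<partial>\<rho>) \<le> ennreal S \<Longrightarrow> 0 \<le> S \<Longrightarrow>
    ereal (- (K * (m + S))) \<le> ext_integral \<rho> V" by (rule ext_integral_V_lower_bound[OF V]) blast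
  have F: "F_fun \<beta> V \<rho> = - enn2ereal (internal_energy \<beta> \<rho>) + ext_integral \<rho> V" if "\<rho> \<in> M2 m" for \<rho>
    using ext_integral_E_fun[OF \<beta> that] by (simp add: F_fun_def)
  have energy_finite: "\<exists>i\<ge>0. internal_energy \<beta> \<rho> = ennreal i" if \<rho>: "\<rho> \<in> M2 m" for \<rho>
  proof -
    obtain S where "0 \<le> S" "(\<integral>\<^sup>+ x. ennreal (x\<^sup>2) \<partial>\<rho>) = ennreal S" by (rule M2_second_moment[OF \<rho>])
    with D(2)[OF \<rho>, of S] m show ?thesis by (cases "internal_energy \<beta> \<rho>") (auto simp: top_unique)
  qed
  have F_lower: "ereal (- ((m + S + 2) * D) - K * (m + S)) \<le> F_fun \<beta> V \<rho>"
    if \<rho>: "\<rho> \<in> M2 m" and S: "(\<integral>\<^sup>+ x. ennreal (x\<^sup>2) \<partial>\<rho>) \<le> ennreal S" "0 \<le> S" for \<rho> S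
  proof -
    obtain i where i: "0 \<le> i" "internal_energy \<beta> \<rho> = ennreal i" using energy_finite[OF \<rho>] by blast
    have nn: "0 \<le> (m + S + 2) * D" using m S D by simp
    have "ennreal i \<le> ennreal ((m + S + 2) * D)" using D(2)[OF \<rho> _ S] m i by simp
    then have "i \<le> (m + S + 2) * D" using nn by (subst (asm) ennreal_le_iff) auto
    then have "ereal (- ((m + S + 2) * D) - K * (m + S)) \<le> ereal (- i) + ereal (- (K * (m + S)))" by simp
    also have "\<dots> \<le> ereal (- i) + ext_integral \<rho> V" using K(2)[OF \<rho> m S] by (intro add_left_mono)
    finally show ?thesis unfolding F[OF \<rho>] i(2) using i(1) by simp
  qed
  have F_gt: "- \<infinity> < F_fun \<beta> V \<rho>" if \<rho>: "\<rho> \<in> M2 m" for \<rho>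
  proof -
    obtain S where "0 \<le> S" "(\<integral>\<^sup>+ x. ennreal (x\<^sup>2) \<partial>\<rho>) = ennreal S" by (rule M2_second_moment[OF \<rho>])
    with F_lower[OF \<rho>, of S] show ?thesis by (cases "F_fun \<beta> V \<rho>") auto
  qed
  have ext_gt: "- \<infinity> < ext_integral \<rho> V" if \<rho>: "\<rho> \<in> M2 m" for \<rho>
  proof -
    obtain S where "0 \<le> S" "(\<integral>\<^sup>+ x. ennreal (x\<^sup>2) \<partial>\<rho>) = ennreal S" by (rule M2_second_moment[OF \<rho>])
    with K(2)[OF \<rho> m, of S] show ?thesis by (cases "ext_integral \<rho> V") auto
  qed

  have lsc: "W2_lower_semicontinuous m (F_fun \<beta> V)"
    unfolding W2_lower_semicontinuous_def
  proof (intro ballI allI impI)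
    fix \<rho> a assume \<rho>: "\<rho> \<in> M2 m" and a: "a < F_fun \<beta> V \<rho>"
    obtain i where i: "0 \<le> i" "internal_energy \<beta> \<rho> = ennreal i" using energy_finite[OF \<rho>] by blast
    have a': "a < - ereal i + ext_integral \<rho> V" using a i by (simp add: F[OF \<rho>])
    \<comment> \<open>Real bounds for the two energies: the internal one may increase by \<open>e\<close>, the potential one may drop to \<open>b\<close>.\<close>
    have "\<exists>b e. 0 < e \<and> ereal b < ext_integral \<rho> V \<and> a \<le> ereal (b - i - e)"
    proof (cases a)
      case (real r)
      show ?thesis
      proof (cases "ext_integral \<rho> V")
        case (real v)
        then show ?thesis using \<open>a = ereal r\<close> a'
          by (intro exI[of _ "v - (v - i - r) / 2"] exI[of _ "(v - i - r) / 2"]) (simp add: field_simps)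
      next
        case PInf
        then show ?thesis using real by (intro exI[of _ "r + i + 1"] exI[of _ 1]) simp
      qed (use ext_gt[OF \<rho>] in auto)
    next
      case MInf
      obtain b where "ereal b < ext_integral \<rho> V"
        using ereal_dense2[OF ext_gt[OF \<rho>]] by blast
      then show ?thesis using MInf by (intro exI[of _ b] exI[of _ 1]) simp
    qed (use a' in auto)
    then obtain b e where be: "0 < e" "ereal b < ext_integral \<rho> V" "a \<le> ereal (b - i - e)" by blast
    obtain \<delta>1 where \<delta>1: "\<delta>1 > 0" "\<And>\<sigma>. \<sigma> \<in> M2 m \<Longrightarrow> W2 \<rho> \<sigma> < \<delta>1 \<Longrightarrow> internal_energy \<beta> \<sigma> \<le> internal_energy \<beta> \<rho> + ennreal e"
      using internal_energy_usc[OF \<beta> \<rho> m be(1)] by blast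
    obtain \<delta>2 where \<delta>2: "\<delta>2 > 0" "\<And>\<sigma>. \<sigma> \<in> M2 m \<Longrightarrow> W2 \<rho> \<sigma> < \<delta>2 \<Longrightarrow> ereal b < ext_integral \<sigma> V"
      using ext_integral_V_lsc[OF V \<rho> m be(2)] by blast
    show "\<exists>\<delta>>0. \<forall>\<sigma>\<in>M2 m. W2 \<rho> \<sigma> < \<delta> \<longrightarrow> a < F_fun \<beta> V \<sigma>"
    proof (intro exI[of _ "min \<delta>1 \<delta>2"] conjI ballI impI)
      show "0 < min \<delta>1 \<delta>2" using \<delta>1 \<delta>2 by simp
      fix \<sigma> assume \<sigma>: "\<sigma> \<in> M2 m" "W2 \<rho> \<sigma> < min \<delta>1 \<delta>2"
      obtain j where j: "0 \<le> j" "internal_energy \<beta> \<sigma> = ennreal j" using energy_finite[OF \<sigma>(1)] by blast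
      have "ennreal j \<le> ennreal (i + e)" using \<delta>1(2)[of \<sigma>] \<sigma> i j be(1) by simp
      then have "j \<le> i + e" using i be(1) by (subst (asm) ennreal_le_iff) auto
      then have "ereal (b - i - e) \<le> ereal (- j) + ereal b" by simp
      also have "\<dots> < ereal (- j) + ext_integral \<sigma> V"
        using \<delta>2(2)[of \<sigma>] \<sigma> by (cases "ext_integral \<sigma> V") auto
      finally show "a < F_fun \<beta> V \<sigma>" using be(3) j unfolding F[OF \<sigma>(1)] by simp
    qed
  qed

  have conv: "displacement_convex m lam (F_fun \<beta> V)"
    unfolding displacement_convex_def
  proof (intro conjI ballI impI)
    fix \<rho>0 \<rho>1 \<theta> assume \<rho>: "\<rho>0 \<in> M2 m" "\<rho>1 \<in> M2 m" and \<theta>: "\<theta> \<in> {0..1::real}"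
      and fin: "F_fun \<beta> V \<rho>0 < \<infinity>" "F_fun \<beta> V \<rho>1 < \<infinity>"
    let ?\<rho> = "displacement_interpolation \<rho>0 \<rho>1 \<theta>"
    have \<rho>': "?\<rho> \<in> M2 m" using \<theta> by (intro displacement_interpolation_M2[OF \<rho> m]) auto
    obtain i0 where i0: "0 \<le> i0" "internal_energy \<beta> \<rho>0 = ennreal i0" using energy_finite[OF \<rho>(1)] by blast
    obtain i1 where i1: "0 \<le> i1" "internal_energy \<beta> \<rho>1 = ennreal i1" using energy_finite[OF \<rho>(2)] by blast
    obtain i where i: "0 \<le> i" "internal_energy \<beta> ?\<rho> = ennreal i" using energy_finite[OF \<rho>'] by blast
    have "ext_integral \<rho>0 V < \<infinity>" using fin(1) i0 unfolding F[OF \<rho>(1)] by (cases "ext_integral \<rho>0 V") auto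
    then have int0: "integrable \<rho>0 V" by (rule ext_integral_finite_imp_integrable[OF V \<rho>(1) m])
    have "ext_integral \<rho>1 V < \<infinity>" using fin(2) i1 unfolding F[OF \<rho>(2)] by (cases "ext_integral \<rho>1 V") auto
    then have int1: "integrable \<rho>1 V" by (rule ext_integral_finite_imp_integrable[OF V \<rho>(2) m])
    define v0 v1 w where "v0 = (\<integral>x. V x \<partial>\<rho>0)" and "v1 = (\<integral>x. V x \<partial>\<rho>1)"
      and "w = lam / 2 * \<theta> * (1 - \<theta>) * (W2 \<rho>0 \<rho>1)\<^sup>2"
    have pot: "ext_integral ?\<rho> V \<le> ereal ((1 - \<theta>) * v0 + \<theta> * v1 - w)"
      unfolding v0_def v1_def w_def using \<theta> by (intro ext_integral_V_convex[OF V \<rho> m _ _ int0 int1]) auto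
    have int: "(1 - \<theta>) * i0 + \<theta> * i1 \<le> i"
    proof -
      \<comment> \<open>At the endpoints an interval for \<open>Z\<close> confines only one of \<open>X\<close> and \<open>Y\<close>, so that \<open>internal_energy_concave\<close> does not apply; there the interpolation is \<open>\<rho>0\<close> or \<open>\<rho>1\<close>.\<close>
      consider "\<theta> = 0" | "\<theta> = 1" | "0 < \<theta>" "\<theta> < 1" using \<theta> by fastforce
      then show ?thesis
      proof cases
        case 1
        then have "?\<rho> = \<rho>0" by (simp add: displacement_interpolation_eq[OF \<rho> m] distr_quantile[OF \<rho>(1) m])
        then show ?thesis using 1 i i0 by simp
      next
        case 2
        then have "?\<rho> = \<rho>1" by (simp add: displacement_interpolation_eq[OF \<rho> m] distr_quantile[OF \<rho>(2) m])
        then show ?thesis using 2 i i1 by simp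
      next
        case 3
        have "ennreal (1 - \<theta>) * ennreal i0 + ennreal \<theta> * ennreal i1 \<le> ennreal i"
          using internal_energy_concave[OF \<beta> \<rho> m 3] by (simp add: i0 i1 i)
        then have "ennreal ((1 - \<theta>) * i0 + \<theta> * i1) \<le> ennreal i"
          using 3 i0 i1 by (simp add: ennreal_mult ennreal_plus)
        then show ?thesis using i(1) by (subst (asm) ennreal_le_iff) auto
      qed
    qed
    have "F_fun \<beta> V ?\<rho> = ereal (- i) + ext_integral ?\<rho> V"
      unfolding F[OF \<rho>'] i(2) using i(1) by simp
    also have "\<dots> \<le> ereal (- i) + ereal ((1 - \<theta>) * v0 + \<theta> * v1 - w)"
      by (rule add_left_mono[OF pot])
    also have "\<dots> \<le> ereal ((1 - \<theta>) * (- i0 + v0) + \<theta> * (- i1 + v1) - w)"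
      using int by (simp add: algebra_simps)
    also have "\<dots> = ereal (1 - \<theta>) * F_fun \<beta> V \<rho>0 + ereal \<theta> * F_fun \<beta> V \<rho>1 - ereal w"
      using i0 i1 by (simp add: F[OF \<rho>(1)] F[OF \<rho>(2)] integrable_imp_ext_integral int0 int1 flip: v0_def v1_def)
    finally show "F_fun \<beta> V ?\<rho> \<le> ereal (1 - \<theta>) * F_fun \<beta> V \<rho>0 + ereal \<theta> * F_fun \<beta> V \<rho>1
        - ereal (lam / 2 * \<theta> * (1 - \<theta>) * (W2 \<rho>0 \<rho>1)\<^sup>2)" by (simp add: w_def)
  qed (rule F_gt)

  have coercive: "- \<infinity> < (INF \<rho>\<in>{\<rho>\<in>M2 m. (\<integral>\<^sup>+ x. ennreal (\<bar>x\<bar>\<^sup>2) \<partial>\<rho>) \<le> ennreal C}. F_fun \<beta> V \<rho>)"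
    if "0 < C" for C
  proof -
    have "- \<infinity> < ereal (- ((m + C + 2) * D) - K * (m + C))" by simp
    also have "\<dots> \<le> (INF \<rho>\<in>{\<rho>\<in>M2 m. (\<integral>\<^sup>+ x. ennreal (\<bar>x\<bar>\<^sup>2) \<partial>\<rho>) \<le> ennreal C}. F_fun \<beta> V \<rho>)"
      using that by (intro INF_greatest F_lower) auto
    finally show ?thesis .
  qed
  show ?thesis using lsc conv coercive by blast
qed

end
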